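(* Let $n\ge 2$, $\sigma\in(0,1)$, and let $J:\mathbb{R}^n\times\mathbb{R}^n\to[0,\infty)$ be a bounded, nonnegative, continuous, symmetric function ($J(x,y)=J(y,x)$) such that (i) for every $y\in\mathbb{R}^n$ the function $x\mapsto J(x,y)$ belongs to $L^1(\mathbb{R}^n)$; (ii) there are constants $c_1,c_2>0$ such that $J(x,y)\ge c_1|x-y|^{-(n+2\sigma)}$ whenever $|x-y|>c_2$. Then, for each $q\in(2\sigma,+\infty)$, the solution $u$ of $$\partial_t u(t,x)=\int_{\mathbb{R}^n}J(x,y)\,[u(t,y)-u(t,x)]\,dy\quad\text{in }\mathbb{R}_+\times\mathbb{R}^n,\qquad u(0,x)=u_0(x),$$ associated to an initial condition $u_0\in L^1(\mathbb{R}^n)\cap L^\infty(\mathbb{R}^n)$ goes to zero in $L^q(\mathbb{R}^n)$ as $t\to+\infty$. Moreover, the solution has an asymptotic decay that can be bounded by $$\limsup_{t\to\infty}\; t^{\frac{n}{2\sigma}\left(1-\frac1q\right)}\|u(t,\cdot)\|_{L^q(\mathbb{R}^n)}\le C\,\|u_0\|_{L^1(\mathbb{R}^n)},$$ and, for all $t>0$, it holds $$\|u(t,\cdot)\|_{L^q(\mathbb{R}^n)}\le C\,\max\{\|u_0\|_{L^1(\mathbb{R}^n)},\|u_0\|_{L^q(\mathbb{R}^n)}\}\;t^{-\frac{n}{2\sigma}\left(1-\frac1q\right)},$$ where the constant $C$ depends on $q$, $\sigma$ and $n$.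
   Context: "The solution" of the Cauchy problem is the solution $u\in C([0,+\infty),L^1(\mathbb{R}^n)\cap L^\infty(\mathbb{R}^n))$ with $u(0,\cdot)=u_0$ given by the following well-posedness result, recalled from the literature: for $J$ as in the claim and $u_0\in L^1(\mathbb{R}^n)\cap L^\infty(\mathbb{R}^n)$ there is a unique solution $u$ in this class, and it satisfies $\|u(t,\cdot)\|_{L^1(\mathbb{R}^n)}\le\|u_0\|_{L^1(\mathbb{R}^n)}$ and $\|u(t,\cdot)\|_{L^\infty(\mathbb{R}^n)}\le\|u_0\|_{L^\infty(\mathbb{R}^n)}$ for all $t\ge0$.
   Formalization: For σ<1/2 the range of q is cut to q≥1 and convergence to zero is claimed only for q>1 (it fails for q≤1, e.g. by conservation of mass); the constant C may depend also on c_1 and c_2, since replacing J by εJ rescales time. *)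

theory Defs
  imports "HOL-Analysis.Analysis" "HOL-Probability.Essential_Supremum"
begin

(* The value is infinite when |f|^p is not integrable, so finiteness of the norm of a measurable
   function expresses membership in L^p, and bounds on it carry content.  Only used with p >= 1. *)
definition Lp_norm :: "real \<Rightarrow> ('a::euclidean_space \<Rightarrow> real) \<Rightarrow> ereal" where
  "Lp_norm p f =
     (if integrable lebesgue (\<lambda>x. \<bar>f x\<bar> powr p)
      then ereal ((LINT x|lebesgue. \<bar>f x\<bar> powr p) powr (1 / p)) else \<infinity>)"

definition Linf_norm :: "('a::euclidean_space \<Rightarrow> real) \<Rightarrow> ereal" where
  "Linf_norm f = esssup lebesgue (\<lambda>x. ereal \<bar>f x\<bar>)"

definition in_L1_Linf :: "('a::euclidean_space \<Rightarrow> real) \<Rightarrow> bool" where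
  "in_L1_Linf f \<longleftrightarrow>
     f \<in> borel_measurable lebesgue \<and> Lp_norm 1 f < \<infinity> \<and> Linf_norm f < \<infinity>"

definition admissible_kernel ::
    "real \<Rightarrow> real \<Rightarrow> real \<Rightarrow> (real ^ 'n \<Rightarrow> real ^ 'n \<Rightarrow> real) \<Rightarrow> bool" where
  "admissible_kernel \<sigma> c\<^sub>1 c\<^sub>2 J \<longleftrightarrow>
     bounded (range (\<lambda>(x, y). J x y)) \<and>
     (\<forall>x y. 0 \<le> J x y) \<and>
     continuous_on UNIV (\<lambda>(x, y). J x y) \<and>
     (\<forall>x y. J x y = J y x) \<and>
     (\<forall>y. integrable lebesgue (\<lambda>x. J x y)) \<and>
     (\<forall>x y. norm (x - y) > c\<^sub>2 \<longrightarrow>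
        J x y \<ge> c\<^sub>1 * norm (x - y) powr - (real CARD('n) + 2 * \<sigma>))"

(* u t stands for the function u(t, .); only t >= 0 matters.  The second and third conjuncts say
   that t |-> u(t, .) is continuous on [0, oo) for the norm of L^1 \<inter> L^oo.  An element of
   C([0, oo), L^1 \<inter> L^oo) has a representative that is continuous in t for almost every x, which
   is why the equation can be asked pointwise in t off a single null set of points x.  The integral
   on the right-hand side converges since J x is integrable and u t is essentially bounded. *)
definition cauchy_solution ::
    "('a::euclidean_space \<Rightarrow> 'a \<Rightarrow> real) \<Rightarrow> ('a \<Rightarrow> real) \<Rightarrow> (real \<Rightarrow> 'a \<Rightarrow> real) \<Rightarrow> bool" where
  "cauchy_solution J u\<^sub>0 u \<longleftrightarrow>
     (\<forall>t\<ge>0. in_L1_Linf (u t)) \<and>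
     (\<forall>t\<ge>0. ((\<lambda>s. Lp_norm 1 (\<lambda>x. u s x - u t x)) \<longlongrightarrow> 0) (at t within {0..})) \<and>
     (\<forall>t\<ge>0. ((\<lambda>s. Linf_norm (\<lambda>x. u s x - u t x)) \<longlongrightarrow> 0) (at t within {0..})) \<and>
     (AE x in lebesgue. u 0 x = u\<^sub>0 x) \<and>
     (AE x in lebesgue. \<forall>t>0.
        ((\<lambda>s. u s x) has_real_derivative (LINT y|lebesgue. J x y * (u t y - u t x))) (at t))"

end

theory Submission
  imports Defs
begin

text \<open>Let \<open>\<psi> r = (\<bar>r\<bar> - m)\<^sub>+\<^sup>p\<close> and split off from \<open>J\<close> the part \<open>j\<close> equal to the constant
  \<open>\<beta> = c\<^sub>1 R powr - (n + 2 \<sigma>)\<close> on the annulus \<open>c\<^sub>2 < \<bar>x - y\<bar> < R\<close> of volume \<open>V\<close>. If \<open>V m\<close> is at least the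
  mass of \<open>\<bar>u\<bar>\<close>, then \<open>j\<close> contributes at most \<open>- p \<beta> V \<psi> u\<close> to \<open>\<partial>\<^sub>t \<psi> u\<close>, and the contribution of
  \<open>J - j\<close> has nonpositive integral by convexity and symmetry; hence \<open>\<integral> \<psi> u\<close> decays at rate \<open>p \<beta> V\<close>.
  With \<open>j = 0\<close> and \<open>p \<rightarrow> 1\<close>, \<open>m \<rightarrow> 0\<close> this gives contraction in \<open>L\<^sup>1\<close>. With \<open>p = q\<close> and \<open>m = M / V\<close>, where \<open>M\<close> is
  the \<open>L\<^sup>1\<close> norm of \<open>u\<^sub>0\<close>, it bounds \<open>\<integral> \<bar>u\<bar>\<^sup>q\<close> at time \<open>t\<close> by an exponentially small multiple of its value
  at time \<open>s\<close> plus a multiple of \<open>V powr - (q - 1) M\<^sup>q\<close>; taking \<open>s = t / 2\<close>, \<open>R\<close> proportional to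
  \<open>t powr (1 / (2 \<sigma>))\<close> and iterating yields the rate.\<close>

section \<open>Truncated powers\<close>

text \<open>Away from 0 the function is locally a smooth power or constant. At 0 the difference
  quotient is at most |h|^(p - 1), which tends to 0 because p > 1.\<close>

lemma pos_part_powr_has_real_derivative:
  fixes p x :: real
  assumes p: "1 < p"
  shows "((\<lambda>r. max 0 r powr p) has_real_derivative p * max 0 x powr (p - 1)) (at x)"
proof -
  consider "x > 0" | "x < 0" | "x = 0" by linarith
  then show ?thesis
  proof cases
    case 1
    have "((\<lambda>r. r powr p) has_real_derivative p * x powr (p - 1)) (at x)"
      using 1 by (auto intro!: derivative_eq_intros)
    moreover have "\<forall>\<^sub>F r in nhds x. r powr p = max 0 r powr p"
      using eventually_nhds_in_open[of "{0<..}" x] 1 by (auto elim!: eventually_mono)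
    ultimately show ?thesis
      using 1 DERIV_cong_ev[of x x "\<lambda>r. r powr p" "\<lambda>r. max 0 r powr p"
          "p * x powr (p - 1)" "p * max 0 x powr (p - 1)"] by simp
  next
    case 2
    have "((\<lambda>r::real. 0) has_real_derivative 0) (at x)" by simp
    moreover have "\<forall>\<^sub>F r in nhds x. 0 = max 0 r powr p"
      using eventually_nhds_in_open[of "{..<0}" x] 2 by (auto elim!: eventually_mono)
    ultimately show ?thesis
      using 2 DERIV_cong_ev[of x x "\<lambda>r. 0" "\<lambda>r. max 0 r powr p"
          0 "p * max 0 x powr (p - 1)"] by simp
  next
    case 3
    have "((\<lambda>h::real. \<bar>h\<bar> powr (p - 1)) \<longlongrightarrow> 0) (at 0)"
      using p by (auto intro!: tendsto_eq_intros)
    moreover have "\<bar>(max 0 h powr p) / h\<bar> \<le> \<bar>h\<bar> powr (p - 1)" for h :: real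
    proof (cases "h > 0")
      case True
      then show ?thesis by (simp add: powr_diff max.absorb2)
    qed (simp add: max.absorb1)
    ultimately have "((\<lambda>h::real. (max 0 h powr p) / h) \<longlongrightarrow> 0) (at 0)"
      using Lim_null_comparison[of "\<lambda>h. (max 0 h powr p) / h" "\<lambda>h. \<bar>h\<bar> powr (p - 1)" "at 0"]
      by (auto simp: real_norm_def)
    then show ?thesis using 3 p by (simp add: DERIV_def)
  qed
qed

text \<open>The function \<psi> of the outline for positive m, split into its right and left
  branches: the chain rule applies to each branch separately, so |s| never has to be differentiated
  at 0.\<close>

definition tpow :: "real \<Rightarrow> real \<Rightarrow> real \<Rightarrow> real" where
  "tpow m p s = max 0 (s - m) powr p + max 0 (- s - m) powr p"

definition tpow' :: "real \<Rightarrow> real \<Rightarrow> real \<Rightarrow> real" where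
  "tpow' m p s = p * max 0 (s - m) powr (p - 1) - p * max 0 (- s - m) powr (p - 1)"

lemma tpow_eq: "0 < m \<Longrightarrow> tpow m p s = max 0 (\<bar>s\<bar> - m) powr p"
  by (auto simp: tpow_def max_def abs_real_def)

lemma tpow_nonneg: "0 \<le> tpow m p s"
  by (simp add: tpow_def)

lemma tpow_eq_0: "0 < m \<Longrightarrow> \<bar>s\<bar> \<le> m \<Longrightarrow> tpow m p s = 0"
  by (simp add: tpow_eq)

lemma tpow_mono: "0 < m \<Longrightarrow> 0 \<le> p \<Longrightarrow> \<bar>s\<bar> \<le> \<bar>t\<bar> \<Longrightarrow> tpow m p s \<le> tpow m p t"
  by (auto simp: tpow_eq intro!: powr_mono2)

lemma tpow_le_powr: "0 < m \<Longrightarrow> 0 \<le> p \<Longrightarrow> tpow m p s \<le> \<bar>s\<bar> powr p"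
  by (auto simp: tpow_eq intro!: powr_mono2)

lemma has_real_derivative_tpow:
  assumes "1 < p"
  shows "(tpow m p has_real_derivative tpow' m p s) (at s)"
proof -
  have "((\<lambda>s. max 0 (s - m) powr p + max 0 (- s - m) powr p) has_real_derivative
      p * max 0 (s - m) powr (p - 1) * 1 + p * max 0 (- s - m) powr (p - 1) * (- 1)) (at s)"
    by (intro DERIV_add DERIV_chain2[OF pos_part_powr_has_real_derivative[OF assms]])
       (auto intro!: derivative_eq_intros)
  then show ?thesis by (simp add: tpow_def[abs_def] tpow'_def)
qed

lemma measurable_tpow[measurable]: "tpow m p \<in> borel_measurable borel"
  unfolding tpow_def[abs_def] by measurable

lemma tpow'_mono: "1 < p \<Longrightarrow> s \<le> t \<Longrightarrow> tpow' m p s \<le> tpow' m p t"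
  unfolding tpow'_def by (intro diff_mono mult_left_mono powr_mono2) auto

text \<open>Convexity: the mean value theorem expresses the increment by a slope at an intermediate
  point, and \<open>tpow'\<close> is monotone.\<close>

lemma tpow_tangent:
  assumes p: "1 < p"
  shows "tpow' m p a * (b - a) \<le> tpow m p b - tpow m p a"
proof (cases a b rule: linorder_cases)
  case less
  then obtain z where "a < z" "tpow m p b - tpow m p a = (b - a) * tpow' m p z"
    using MVT2[OF less has_real_derivative_tpow[OF p]] by blast
  then show ?thesis using less tpow'_mono[OF p, of a z m] by (simp add: mult.commute mult_left_mono)
next
  case greater
  then obtain z where "z < a" "tpow m p a - tpow m p b = (a - b) * tpow' m p z"
    using MVT2[OF greater has_real_derivative_tpow[OF p]] by blast
  moreover have "(a - b) * tpow' m p z \<le> (a - b) * tpow' m p a"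
    using greater tpow'_mono[OF p, of z a m] \<open>z < a\<close> by (intro mult_left_mono) auto
  ultimately show ?thesis by (simp add: algebra_simps)
qed simp

text \<open>Here b stands for the average of the solution against \<open>j\<close> and \<alpha> for
  the total mass of \<open>j\<close>. For s > m the second factor is at most -\<alpha> (s - m), and
  p (s - m)^(p - 1) times (s - m) restores p times the truncated power. The case s < -m is
  symmetric, and for |s| \<le> m both sides vanish.\<close>

lemma tpow'_decay:
  assumes p: "1 < p" and m: "0 < m" and b: "\<bar>b\<bar> \<le> \<alpha> * m"
  shows "tpow' m p s * (b - \<alpha> * s) \<le> - (\<alpha> * p) * tpow m p s"
proof -
  have pw: "x powr (p - 1) * x = x powr p" if "x > 0" for x :: real
    using that by (simp add: powr_diff)
  consider "\<bar>s\<bar> \<le> m" | "s > m" | "s < - m" by linarith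
  then show ?thesis
  proof cases
    case 1
    then have "max 0 (s - m) = 0" "max 0 (- s - m) = 0" by auto
    then show ?thesis by (simp add: tpow_def tpow'_def)
  next
    case 2
    have "p * (s - m) powr (p - 1) * (b - \<alpha> * s) \<le> p * (s - m) powr (p - 1) * (- \<alpha> * (s - m))"
      using b p by (intro mult_left_mono) (auto simp: algebra_simps)
    also have "\<dots> = - (\<alpha> * p) * ((s - m) powr (p - 1) * (s - m))" by (simp add: algebra_simps)
    finally show ?thesis using 2 m pw[of "s - m"] by (simp add: tpow_def tpow'_def max_def)
  next
    case 3
    have "p * (- s - m) powr (p - 1) * (\<alpha> * s - b) \<le> p * (- s - m) powr (p - 1) * (- \<alpha> * (- s - m))"
      using b p by (intro mult_left_mono) (auto simp: algebra_simps)
    also have "\<dots> = - (\<alpha> * p) * ((- s - m) powr (p - 1) * (- s - m))" by (simp add: algebra_simps)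
    also have "(- s - m) powr (p - 1) * (- s - m) = (- s - m) powr p" using 3 by (intro pw) simp
    finally have "- (p * (- s - m) powr (p - 1)) * (b - \<alpha> * s) \<le> - (\<alpha> * p) * (- s - m) powr p"
      by (simp add: algebra_simps)
    then show ?thesis using 3 m by (simp add: tpow_def tpow'_def max_def)
  qed
qed

text \<open>If |a| \<le> m, the derivative vanishes. If |b| \<le> m < |a|, the tangent inequality
  gives the bound \<open>- tpow m p a\<close>, which is at most 0. The right-hand side is
  antisymmetric in a and b and nonzero only when both exceed m in absolute value.\<close>

lemma tpow'_increment_le:
  assumes p: "1 < p" and m: "0 < m"
  shows "tpow' m p a * (b - a) \<le>
    (if m < \<bar>a\<bar> \<and> m < \<bar>b\<bar> then tpow m p b - tpow m p a else 0)"
proof (cases "\<bar>a\<bar> \<le> m")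
  case True
  then have "max 0 (a - m) = 0" "max 0 (- a - m) = 0" by auto
  then have "tpow' m p a = 0" by (simp add: tpow'_def)
  then show ?thesis using True by simp
next
  case False
  then show ?thesis using tpow_tangent[OF p, of m a b] tpow_eq_0[OF m, of b p] tpow_nonneg[of m p a]
    by (cases "m < \<bar>b\<bar>") auto
qed


section \<open>Decay of truncated powers\<close>

lemma (in pair_sigma_finite) integrable_mult_fst_snd:
  fixes f :: "'a \<Rightarrow> real" and g :: "'b \<Rightarrow> real"
  assumes "integrable M1 f" "integrable M2 g"
  shows "integrable (M1 \<Otimes>\<^sub>M M2) (\<lambda>(x, y). f x * g y)"
  using assms by (intro Fubini_integrable) (auto simp: abs_mult)

text \<open>Exchanging the order of integration and then the names of the variables shows that the
  integral equals its own negative.\<close>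

lemma (in sigma_finite_measure) integral_antisym_eq_0:
  fixes h :: "'a \<Rightarrow> 'a \<Rightarrow> real"
  assumes "integrable (M \<Otimes>\<^sub>M M) (\<lambda>(x, y). h x y)" "\<And>x y. h y x = - h x y"
  shows "(\<integral>x. \<integral>y. h x y \<partial>M \<partial>M) = 0"
proof -
  interpret pair_sigma_finite M M ..
  have "(\<integral>x. \<integral>y. h x y \<partial>M \<partial>M) = (\<integral>y. \<integral>x. h x y \<partial>M \<partial>M)"
    using Fubini_integral[OF assms(1)] by simp
  also have "\<dots> = - (\<integral>y. \<integral>x. h y x \<partial>M \<partial>M)"
    by (subst (2) assms(2)) simp
  finally show ?thesis by simp
qed

text \<open>The integrals of \<^term>\<open>J x\<close> need not be bounded uniformly in \<^term>\<open>x\<close>: only pairs of points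
  of the set \<open>\<bar>v t\<bar> > m\<close>, which has finite measure, contribute to the exchange term, so there the bounded
  kernel is integrable and antisymmetry makes the exchange term vanish.\<close>
lemma (in sigma_finite_measure) integral_tpow_decay:
  fixes J j :: "'a \<Rightarrow> 'a \<Rightarrow> real" and v :: "real \<Rightarrow> 'a \<Rightarrow> real"
  assumes p: "1 < p" and m: "0 < m" and T: "0 \<le> T"
    and Jm[measurable]: "(\<lambda>(x, y). J x y) \<in> borel_measurable (M \<Otimes>\<^sub>M M)"
    and jm[measurable]: "(\<lambda>(x, y). j x y) \<in> borel_measurable (M \<Otimes>\<^sub>M M)"
    and J_le: "\<And>x y. J x y \<le> K" and J_sym: "\<And>x y. J x y = J y x"
    and J_int: "\<And>x. x \<in> space M \<Longrightarrow> integrable M (J x)"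
    and j_nonneg: "\<And>x y. 0 \<le> j x y" and j_le: "\<And>x y. j x y \<le> J x y" and j_sym: "\<And>x y. j x y = j y x"
    and j_le_\<beta>: "\<And>x y. j x y \<le> \<beta>" and j_integral: "\<And>x. x \<in> space M \<Longrightarrow> (\<integral>y. j x y \<partial>M) = \<alpha>"
    and vm[measurable]: "(\<lambda>(t, x). v t x) \<in> borel_measurable (borel \<Otimes>\<^sub>M M)"
    and v_le: "\<And>t x. t \<in> {0..T} \<Longrightarrow> \<bar>v t x\<bar> \<le> S"
    and v_int: "\<And>t. t \<in> {0..T} \<Longrightarrow> integrable M (v t)"
    and v_L1: "\<And>t. t \<in> {0..T} \<Longrightarrow> (\<integral>x. \<bar>v t x\<bar> \<partial>M) \<le> B"
    and v_cont: "\<And>x. x \<in> space M \<Longrightarrow> continuous_on {0..T} (\<lambda>t. v t x)"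
    and v_deriv: "AE x in M. \<forall>t\<in>{0<..<T}.
       ((\<lambda>s. v s x) has_real_derivative (\<integral>y. J x y * (v t y - v t x) \<partial>M)) (at t)"
    and \<beta>B: "\<beta> * B \<le> \<alpha> * m"
  shows "(\<integral>x. tpow m p (v T x) \<partial>M) \<le> exp (- (\<alpha> * p) * T) * (\<integral>x. tpow m p (v 0 x) \<partial>M)"
proof -
  interpret MM: pair_sigma_finite M M ..
  interpret TM: pair_sigma_finite lborel M ..
  \<comment> \<open>The remaining kernel: \<open>j\<close> produces the decay, while
    \<open>k\<close> only has to be shown not to increase the integral.\<close>
  define k where "k x y = J x y - j x y" for x y
  have k_nonneg: "0 \<le> k x y" and k_le: "k x y \<le> K" and k_sym: "k x y = k y x" for x y
    using j_le[of x y] J_le[of x y] j_nonneg[of x y] J_sym[of x y] j_sym[of x y] by (auto simp: k_def)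
  have [measurable]: "(\<lambda>(x, y). k x y) \<in> borel_measurable (M \<Otimes>\<^sub>M M)"
    unfolding k_def by measurable
  define d where "d a b = (if m < \<bar>a\<bar> \<and> m < \<bar>b\<bar> then tpow m p b - tpow m p a else 0)" for a b
  have [measurable]: "(\<lambda>(a, b). d a b) \<in> borel_measurable (borel \<Otimes>\<^sub>M borel)"
    unfolding d_def by measurable
  have vt[measurable]: "v t \<in> borel_measurable M" for t
    using measurable_compose[OF measurable_Pair1' vm, of t] by simp
  define h where "h t x y = k x y * d (v t x) (v t y)" for t x y
  define H where "H t x = (\<integral>y. h t x y \<partial>M)" for t x
  define D where "D = tpow m p S"
  have D: "0 \<le> D" by (simp add: D_def tpow_nonneg)
  have hm[measurable]: "(\<lambda>(z, y). h (fst z) (snd z) y) \<in> borel_measurable ((borel \<Otimes>\<^sub>M M) \<Otimes>\<^sub>M M)"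
    unfolding h_def by measurable
  have Hm[measurable]: "(\<lambda>(t, x). H t x) \<in> borel_measurable (borel \<Otimes>\<^sub>M M)"
    using borel_measurable_lebesgue_integral[OF hm] by (simp add: H_def case_prod_beta)
  have htm[measurable]: "(\<lambda>(x, y). h t x y) \<in> borel_measurable (M \<Otimes>\<^sub>M M)" for t
    unfolding h_def by measurable
  have K: "0 \<le> K" if "x \<in> space M" for x :: 'a
    using k_nonneg[of x x] k_le[of x x] by linarith
  \<comment> \<open>Where \<open>d\<close> does not vanish, both values exceed m, so 1 is at most
    their product divided by m^2. This turns the constant bound D into a product of integrable
    functions.\<close>
  have d_bound: "\<bar>d (v t x) (v t y)\<bar> \<le> D / m\<^sup>2 * (\<bar>v t x\<bar> * \<bar>v t y\<bar>)" if t: "t \<in> {0..T}" for t x y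
  proof (cases "m < \<bar>v t x\<bar> \<and> m < \<bar>v t y\<bar>")
    case True
    have "tpow m p (v t z) \<le> D" for z
      unfolding D_def using v_le[OF t, of z] p m by (intro tpow_mono) auto
    then have "\<bar>d (v t x) (v t y)\<bar> \<le> D"
      using tpow_nonneg[of m p "v t x"] tpow_nonneg[of m p "v t y"]
      by (simp add: d_def True abs_le_iff) (smt (verit))
    also have "D = D / m\<^sup>2 * (m * m)" using m by (simp add: power2_eq_square)
    also have "\<dots> \<le> D / m\<^sup>2 * (\<bar>v t x\<bar> * \<bar>v t y\<bar>)"
      using True m D by (intro mult_left_mono mult_mono) auto
    finally show ?thesis .
  qed (use D in \<open>auto simp: d_def\<close>)
  define C where "C = K * D / m\<^sup>2"
  have h_bound: "\<bar>h t x y\<bar> \<le> C * (\<bar>v t x\<bar> * \<bar>v t y\<bar>)" if t: "t \<in> {0..T}" for t x y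
  proof -
    have "\<bar>h t x y\<bar> \<le> K * (D / m\<^sup>2 * (\<bar>v t x\<bar> * \<bar>v t y\<bar>))"
      unfolding h_def abs_mult using k_nonneg[of x y] k_le[of x y] d_bound[OF t]
      by (intro mult_mono) auto
    then show ?thesis by (simp add: C_def)
  qed
  have h_int: "integrable (M \<Otimes>\<^sub>M M) (\<lambda>(x, y). h t x y)" if t: "t \<in> {0..T}" for t
  proof (rule Bochner_Integration.integrable_bound)
    show "integrable (M \<Otimes>\<^sub>M M) (\<lambda>z. C * (\<lambda>(x, y). \<bar>v t x\<bar> * \<bar>v t y\<bar>) z)"
      using v_int[OF t] by (intro integrable_mult_right MM.integrable_mult_fst_snd integrable_abs)
    show "AE z in M \<Otimes>\<^sub>M M. norm ((\<lambda>(x, y). h t x y) z) \<le> norm (C * (\<lambda>(x, y). \<bar>v t x\<bar> * \<bar>v t y\<bar>) z)"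
      using h_bound[OF t] by (intro AE_I2) (auto intro: order_trans[OF _ abs_ge_self])
  qed measurable
  have H_0: "(\<integral>x. H t x \<partial>M) = 0" if t: "t \<in> {0..T}" for t
    unfolding H_def
    by (rule integral_antisym_eq_0[OF h_int[OF t]]) (auto simp: h_def d_def algebra_simps k_sym[of x y for x y])
  have H_int: "integrable M (H t)" if t: "t \<in> {0..T}" for t
    unfolding H_def using MM.integrable_fst[OF h_int[OF t]] .
  have "0 \<le> (\<integral>x. \<bar>v 0 x\<bar> \<partial>M)" by simp
  also have "\<dots> \<le> B" using v_L1[of 0] T by simp
  finally have B: "0 \<le> B" .
  have htx_int: "integrable M (h t x)" if t: "t \<in> {0..T}" and x: "x \<in> space M" for t x
  proof (rule Bochner_Integration.integrable_bound)
    show "integrable M (\<lambda>y. C * (\<bar>v t x\<bar> * \<bar>v t y\<bar>))" using v_int[OF t] by auto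
    show "h t x \<in> borel_measurable M" using x by measurable
    show "AE y in M. norm (h t x y) \<le> norm (C * (\<bar>v t x\<bar> * \<bar>v t y\<bar>))"
      using h_bound[OF t] by (intro AE_I2) (auto intro: order_trans[OF _ abs_ge_self])
  qed
  have H_bound: "\<bar>H t x\<bar> \<le> \<bar>C\<bar> * B * \<bar>v t x\<bar>" if t: "t \<in> {0..T}" and x: "x \<in> space M" for t x
  proof -
    have "norm (H t x) \<le> (\<integral>y. \<bar>C\<bar> * \<bar>v t x\<bar> * \<bar>v t y\<bar> \<partial>M)"
      unfolding H_def
    proof (rule order_trans[OF integral_norm_bound integral_mono])
      show "integrable M (\<lambda>y. \<bar>C\<bar> * \<bar>v t x\<bar> * \<bar>v t y\<bar>)" using v_int[OF t] by auto
      show "norm (h t x y) \<le> \<bar>C\<bar> * \<bar>v t x\<bar> * \<bar>v t y\<bar>" for y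
        using order_trans[OF h_bound[OF t, of x y] mult_right_mono[OF abs_ge_self]] by (simp add: mult.assoc)
    qed (intro integrable_norm htx_int[OF t x])
    also have "\<dots> = \<bar>C\<bar> * \<bar>v t x\<bar> * (\<integral>y. \<bar>v t y\<bar> \<partial>M)" by simp
    also have "\<dots> \<le> \<bar>C\<bar> * \<bar>v t x\<bar> * B" by (intro mult_left_mono v_L1[OF t]) auto
    finally show ?thesis by (simp add: mult_ac)
  qed
  \<comment> \<open>The weight is the integrating factor for decay at rate \<alpha> p. The cutoff to
    {0..T} lets Fubini be applied on the whole time line.\<close>
  define F where "F t x = indicator {0..T} t * exp (\<alpha> * p * t) * H t x" for t x
  have Fm[measurable]: "(\<lambda>(t, x). F t x) \<in> borel_measurable (lborel \<Otimes>\<^sub>M M)"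
    unfolding F_def by measurable
  have F_int: "integrable (lborel \<Otimes>\<^sub>M M) (\<lambda>(t, x). F t x)"
  proof (rule TM.Fubini_integrable[OF Fm])
    have "integrable M (\<lambda>y. F t y)" for t
      using H_int[of t] by (cases "t \<in> {0..T}") (auto simp: F_def)
    then show "AE t in lborel. integrable M (\<lambda>y. case (t, y) of (t, x) \<Rightarrow> F t x)" by simp
    \<comment> \<open>The exponential bounds the weight on {0..T}; one factor B comes from
      \<open>H_bound\<close>, the other from integrating that bound over the space.\<close>
    define E where "E = exp (\<bar>\<alpha> * p\<bar> * T) * (\<bar>C\<bar> * B * B)"
    show "integrable lborel (\<lambda>t. \<integral>y. norm (case (t, y) of (t, x) \<Rightarrow> F t x) \<partial>M)"
    proof (rule Bochner_Integration.integrable_bound)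
      show "integrable lborel (\<lambda>t. indicator {0..T} t * E :: real)"
        by (intro integrable_mult_left integrable_real_indicator) (auto simp: emeasure_lborel_Icc_eq)
      have "\<bar>\<integral>y. \<bar>F t y\<bar> \<partial>M\<bar> \<le> \<bar>E\<bar>" if t: "t \<in> {0..T}" for t
      proof -
        have "(\<integral>y. \<bar>F t y\<bar> \<partial>M) = exp (\<alpha> * p * t) * (\<integral>y. \<bar>H t y\<bar> \<partial>M)"
          using t by (simp add: F_def abs_mult)
        also have "(\<integral>y. \<bar>H t y\<bar> \<partial>M) \<le> (\<integral>y. \<bar>C\<bar> * B * \<bar>v t y\<bar> \<partial>M)"
          using H_int[OF t] v_int[OF t] H_bound[OF t] by (intro integral_mono) auto
        also have "\<dots> \<le> \<bar>C\<bar> * B * B" using v_L1[OF t] B by (auto intro!: mult_left_mono)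
        also have "exp (\<alpha> * p * t) \<le> exp (\<bar>\<alpha> * p\<bar> * T)"
          using t by (auto intro!: order_trans[OF mult_right_mono[OF abs_ge_self] mult_left_mono])
        finally have "(\<integral>y. \<bar>F t y\<bar> \<partial>M) \<le> E"
          using B by (simp add: E_def mult_left_mono mult_right_mono)
        then show ?thesis using abs_ge_self[of E] by simp
      qed
      then show "AE t in lborel. norm (\<integral>y. norm (case (t, y) of (t, x) \<Rightarrow> F t x) \<partial>M)
          \<le> norm (indicator {0..T} t * E :: real)"
        by (intro AE_I2) (auto simp: F_def indicator_def)
    qed measurable
  qed
  have tpow_int: "integrable M (\<lambda>x. tpow m p (v t x))" if t: "t \<in> {0..T}" for t
  proof (rule Bochner_Integration.integrable_bound)
    \<comment> \<open>As in \<open>d_bound\<close>: where the truncated power is nonzero, |v| / m is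
      at least 1.\<close>
    show "integrable M (\<lambda>x. D / m * \<bar>v t x\<bar>)" using v_int[OF t] by auto
    have "tpow m p (v t x) \<le> D / m * \<bar>v t x\<bar>" for x
    proof (cases "\<bar>v t x\<bar> \<le> m")
      case False
      have "tpow m p (v t x) \<le> D"
        unfolding D_def using v_le[OF t, of x] p m by (intro tpow_mono) auto
      also have "D = D / m * m" using m by simp
      also have "\<dots> \<le> D / m * \<bar>v t x\<bar>" using False m D by (intro mult_left_mono) auto
      finally show ?thesis .
    qed (use m D in \<open>auto simp: tpow_eq_0\<close>)
    then show "AE x in M. norm (tpow m p (v t x)) \<le> norm (D / m * \<bar>v t x\<bar>)"
      using m D by (intro AE_I2) (simp add: tpow_nonneg abs_mult)
  qed measurable
  \<comment> \<open>The differential inequality is first integrated in time at a fixed point x; the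
    integration over x comes afterwards.\<close>
  have "AE x in M. exp (\<alpha> * p * T) * tpow m p (v T x) - tpow m p (v 0 x) \<le> (\<integral>t. F t x \<partial>lborel)"
    using v_deriv TM.AE_integrable_snd[OF F_int] AE_space
  proof eventually_elim
    case (elim x)
    note x = elim(3)
    have Jmx[measurable]: "J x \<in> borel_measurable M" and jmx[measurable]: "j x \<in> borel_measurable M"
      and kmx[measurable]: "k x \<in> borel_measurable M"
      using x by measurable
    let ?f = "\<lambda>t. exp (\<alpha> * p * t) * tpow m p (v t x)"
    let ?I = "\<lambda>t. \<integral>y. J x y * (v t y - v t x) \<partial>M"
    let ?f' = "\<lambda>t. exp (\<alpha> * p * t) * (\<alpha> * p * tpow m p (v t x) + tpow' m p (v t x) * ?I t)"
    have 1: "(?f has_real_derivative ?f' t) (at t)" if t: "t \<in> {0<..<T}" for t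
    proof -
      have "((\<lambda>s. v s x) has_real_derivative ?I t) (at t)" using elim(1) t by blast
      from DERIV_chain2[OF has_real_derivative_tpow[OF p] this]
      have *: "((\<lambda>s. tpow m p (v s x)) has_real_derivative tpow' m p (v t x) * ?I t) (at t)" .
      show ?thesis
        by (rule derivative_eq_intros * refl)+ (simp add: algebra_simps)
    qed
    \<comment> \<open>The \<open>j\<close> part of the equation cancels the term \<alpha> p \<psi>
      created by the integrating factor, and the \<open>k\<close> part is dominated by
      \<open>h\<close>.\<close>
    have 2: "?f' t \<le> F t x" if t: "t \<in> {0..T}" for t
    proof -
      have ij: "integrable M (j x)"
        by (rule Bochner_Integration.integrable_bound[OF J_int[OF x]])
           (use j_nonneg order_trans[OF j_le abs_ge_self] in \<open>auto intro!: AE_I2\<close>)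
      have mult_int: "integrable M (\<lambda>y. g y * w y)"
        if "integrable M g" "w \<in> borel_measurable M" "\<And>y. \<bar>w y\<bar> \<le> c" for g w :: "'a \<Rightarrow> real" and c
      proof (rule Bochner_Integration.integrable_bound)
        show "integrable M (\<lambda>y. g y * c)" using that by simp
        show "AE y in M. norm (g y * w y) \<le> norm (g y * c)"
          using order_trans[OF that(3) abs_ge_self] by (intro AE_I2) (simp add: abs_mult mult_left_mono)
      qed (use that in measurable)
      have ik: "integrable M (k x)" unfolding k_def using J_int[OF x] ij by auto
      have diff_le: "\<bar>v t y - v t x\<bar> \<le> 2 * S" for y using v_le[OF t, of x] v_le[OF t, of y] by linarith
      have i1: "integrable M (\<lambda>y. k x y * (v t y - v t x))" "integrable M (\<lambda>y. j x y * (v t y - v t x))"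
        by (rule mult_int[OF ik _ diff_le], measurable, rule mult_int[OF ij _ diff_le], measurable)
      have i2: "integrable M (\<lambda>y. j x y * v t y)"
        by (rule mult_int[OF ij _ v_le[OF t]]) measurable
      have "?I t = (\<integral>y. k x y * (v t y - v t x) + j x y * (v t y - v t x) \<partial>M)"
        by (simp add: k_def algebra_simps)
      also have "\<dots> = (\<integral>y. k x y * (v t y - v t x) \<partial>M) + (\<integral>y. j x y * (v t y - v t x) \<partial>M)"
        using i1 by simp
      also have "(\<integral>y. j x y * (v t y - v t x) \<partial>M) = (\<integral>y. j x y * v t y \<partial>M) - \<alpha> * v t x"
        using i2 ij by (simp add: right_diff_distrib j_integral[OF x])
      finally have I: "?I t = (\<integral>y. k x y * (v t y - v t x) \<partial>M) + ((\<integral>y. j x y * v t y \<partial>M) - \<alpha> * v t x)" .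
      have "\<bar>\<integral>y. j x y * v t y \<partial>M\<bar> \<le> (\<integral>y. \<beta> * \<bar>v t y\<bar> \<partial>M)"
      proof (rule order_trans[OF integral_abs_bound integral_mono])
        show "integrable M (\<lambda>y. \<bar>j x y * v t y\<bar>)" by (intro integrable_abs i2)
        show "integrable M (\<lambda>y. \<beta> * \<bar>v t y\<bar>)" using v_int[OF t] by auto
        show "\<bar>j x y * v t y\<bar> \<le> \<beta> * \<bar>v t y\<bar>" for y
          using j_nonneg[of x y] j_le_\<beta>[of x y] by (auto simp: abs_mult intro: mult_right_mono)
      qed
      also have "\<dots> \<le> \<beta> * B"
        using v_L1[OF t] order_trans[OF j_nonneg j_le_\<beta>] by (auto intro!: mult_left_mono)
      finally have "\<bar>\<integral>y. j x y * v t y \<partial>M\<bar> \<le> \<alpha> * m" using \<beta>B by linarith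
      note decay = tpow'_decay[OF p m this, of "v t x"]
      have "tpow' m p (v t x) * (\<integral>y. k x y * (v t y - v t x) \<partial>M)
          = (\<integral>y. k x y * (tpow' m p (v t x) * (v t y - v t x)) \<partial>M)"
        by (simp add: integral_mult_right_zero[symmetric] mult_ac del: integral_mult_right_zero)
      also have "\<dots> \<le> (\<integral>y. h t x y \<partial>M)"
      proof (rule integral_mono)
        show "integrable M (\<lambda>y. k x y * (tpow' m p (v t x) * (v t y - v t x)))"
          using integrable_mult_right[OF i1(1), of "tpow' m p (v t x)"] by (simp add: mult_ac)
        show "k x y * (tpow' m p (v t x) * (v t y - v t x)) \<le> h t x y" for y
          unfolding h_def d_def using k_nonneg[of x y] tpow'_increment_le[OF p m]
          by (intro mult_left_mono) auto
      qed (rule htx_int[OF t x])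
      finally have "tpow' m p (v t x) * ?I t \<le> H t x - \<alpha> * p * tpow m p (v t x)"
        using decay by (simp add: I H_def distrib_left)
      then show ?thesis using t by (simp add: F_def)
    qed
    \<comment> \<open>The derivative is known only in the open interval, so continuity supplies the
      endpoints. The fundamental theorem yields a Henstock-Kurzweil integral of \<open>?f'\<close>
      without prior integrability, and the comparison with \<open>F\<close> is made for that
      integral.\<close>
    have 3: "(?f' has_integral (?f T - ?f 0)) {0..T}"
    proof (rule fundamental_theorem_of_calculus_interior[OF T])
      show "continuous_on {0..T} ?f"
        using continuous_on_compose2[OF _ v_cont[OF x] subset_UNIV, of "tpow m p"]
          DERIV_continuous_on[OF has_real_derivative_tpow[OF p, THEN DERIV_subset], of UNIV m]
        by (intro continuous_intros) auto
    qed (use 1 in \<open>auto simp: has_real_derivative_iff_has_vector_derivative[symmetric]\<close>)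
    have "((\<lambda>t. if t \<in> {0..T} then F t x else 0) has_integral (\<integral>t. F t x \<partial>lborel)) UNIV"
      using has_integral_integral_lborel[OF elim(2)]
      by (rule has_integral_eq[rotated]) (auto simp: F_def)
    then have 4: "((\<lambda>t. F t x) has_integral (\<integral>t. F t x \<partial>lborel)) {0..T}"
      by (simp only: has_integral_restrict_UNIV)
    show ?case using has_integral_le[OF 3 4 2] by simp
  qed
  \<comment> \<open>After integration over x and exchange of the integrals, the right-hand side
    consists of the space integrals of \<open>F t\<close>, each of which is 0 by
    antisymmetry.\<close>
  then have "(\<integral>x. exp (\<alpha> * p * T) * tpow m p (v T x) - tpow m p (v 0 x) \<partial>M) \<le> (\<integral>x. \<integral>t. F t x \<partial>lborel \<partial>M)"
    using tpow_int[of T] tpow_int[of 0] T by (intro integral_mono_AE TM.integrable_snd[OF F_int]) auto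
  also have "\<dots> = (\<integral>t. \<integral>x. F t x \<partial>M \<partial>lborel)"
    using TM.Fubini_integral[OF F_int] .
  also have "\<dots> = 0"
  proof -
    have "(\<integral>x. F t x \<partial>M) = 0" for t
      using H_0[of t] by (cases "t \<in> {0..T}") (auto simp: F_def)
    then show ?thesis by simp
  qed
  finally have "exp (\<alpha> * p * T) * (\<integral>x. tpow m p (v T x) \<partial>M) \<le> (\<integral>x. tpow m p (v 0 x) \<partial>M)"
    using tpow_int[of T] tpow_int[of 0] T by simp
  then show ?thesis by (simp add: exp_minus field_simps)
qed

section \<open>Time-continuous representatives\<close>

lemma Lp_norm_1: "integrable lebesgue f \<Longrightarrow> Lp_norm 1 f = ereal (\<integral>x. \<bar>f x\<bar> \<partial>lebesgue)"
  by (simp add: Lp_norm_def)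

lemma in_L1_Linf_imp_integrable:
  assumes "in_L1_Linf f"
  shows "integrable lebesgue f"
proof -
  have "integrable lebesgue (\<lambda>x. \<bar>f x\<bar>)"
    using assms by (auto simp: in_L1_Linf_def Lp_norm_def split: if_splits)
  then show ?thesis using assms integrable_abs_cancel by (auto simp: in_L1_Linf_def)
qed

lemma AE_le_Linf_norm: "AE x in lebesgue. ereal \<bar>f x\<bar> \<le> Linf_norm f"
  unfolding Linf_norm_def by (rule esssup_AE)

text \<open>A negative essential bound on |f| would hold nowhere, which would make the whole space a
  null set.\<close>

lemma Linf_norm_nonneg: "0 \<le> Linf_norm (f :: 'a::euclidean_space \<Rightarrow> real)"
proof (rule ccontr)
  assume "\<not> 0 \<le> Linf_norm f"
  then have "AE x in lebesgue. \<not> ereal \<bar>f x\<bar> \<le> Linf_norm f"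
    by (intro AE_I2) (meson abs_ge_zero ereal_less_eq(5) order_trans)
  with AE_le_Linf_norm[of f] have "AE x in (lebesgue :: 'a measure). False"
    by eventually_elim simp
  then show False by (simp add: AE_iff_null null_sets_def)
qed

lemma in_L1_Linf_AE_bound:
  assumes "in_L1_Linf f"
  shows "AE x in lebesgue. \<bar>f x\<bar> \<le> real_of_ereal (Linf_norm f)"
proof -
  have "ereal (real_of_ereal (Linf_norm f)) = Linf_norm f"
    using assms Linf_norm_nonneg[of f] by (intro ereal_real') (auto simp: in_L1_Linf_def)
  then show ?thesis using AE_le_Linf_norm[of f] by (metis (mono_tags, lifting) AE_mp AE_I2 ereal_less_eq(3))
qed

text \<open>By compactness finitely many of the neighbourhoods cover the interval. It serves to
  bound norms of the solution uniformly on bounded time intervals.\<close>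

lemma locally_bounded_imp_bounded_Icc:
  fixes f :: "real \<Rightarrow> real"
  assumes "\<And>t. 0 \<le> t \<Longrightarrow> \<forall>\<^sub>F s in at t within {0..}. f s \<le> f t + 1"
  shows "\<exists>S. \<forall>t\<in>{0..T}. f t \<le> S"
proof -
  have "\<exists>U. open U \<and> t \<in> U \<and> (\<forall>s\<in>U \<inter> {0..}. f s \<le> f t + 1)" if t: "t \<in> {0..T}" for t
  proof -
    obtain U where U: "open U" "t \<in> U" "\<And>s. s \<in> U \<Longrightarrow> s \<noteq> t \<Longrightarrow> s \<in> {0..} \<Longrightarrow> f s \<le> f t + 1"
      using assms[of t] t unfolding eventually_at_topological by auto
    moreover have "f s \<le> f t + 1" if "s \<in> U \<inter> {0..}" for s
      using U(3)[of s] that by (cases "s = t") auto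
    ultimately show ?thesis by blast
  qed
  then obtain U where U: "\<And>t. t \<in> {0..T} \<Longrightarrow> open (U t)" "\<And>t. t \<in> {0..T} \<Longrightarrow> t \<in> U t"
      "\<And>t s. t \<in> {0..T} \<Longrightarrow> s \<in> U t \<inter> {0..} \<Longrightarrow> f s \<le> f t + 1"
    by metis
  obtain C where C: "C \<subseteq> {0..T}" "finite C" "{0..T} \<subseteq> (\<Union>t\<in>C. U t)"
    using compactE_image[of "{0..T}" "{0..T}" U] U(1,2) compact_Icc by blast
  \<comment> \<open>A sum of nonnegative terms replaces the maximum over the centres, so an empty
    cover needs no separate treatment.\<close>
  have "f t \<le> (\<Sum>c\<in>C. \<bar>f c\<bar> + 1)" if t: "t \<in> {0..T}" for t
  proof -
    obtain c where c: "c \<in> C" "t \<in> U c" using C(3) t by blast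
    then have "f t \<le> f c + 1" using C(1) t by (intro U(3)) auto
    then have "f t \<le> \<bar>f c\<bar> + 1" by linarith
    also have "\<dots> \<le> (\<Sum>c\<in>C. \<bar>f c\<bar> + 1)"
      using C(2) c(1) by (intro member_le_sum) auto
    finally show ?thesis .
  qed
  then show ?thesis by blast
qed

text \<open>This passes from countably many times, where almost-everywhere bounds share one
  exceptional null set, to all times.\<close>

lemma le_on_Rats_imp_le:
  fixes g :: "real \<Rightarrow> real"
  assumes cont: "continuous_on {a<..<b} g" and le: "\<And>r. r \<in> \<rat> \<Longrightarrow> a < r \<Longrightarrow> r < b \<Longrightarrow> g r \<le> S"
    and t: "a < t" "t < b"
  shows "g t \<le> S"
proof (rule ccontr)
  assume "\<not> g t \<le> S"
  moreover have "isCont g t" using cont t by (simp add: continuous_on_eq_continuous_at)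
  ultimately have "\<forall>\<^sub>F s in at t. S < g s"
    by (intro order_tendstoD(1)[of g "g t"]) (auto simp: isCont_def)
  then obtain d where d: "d > 0" "\<And>s. s \<noteq> t \<Longrightarrow> dist s t < d \<Longrightarrow> S < g s"
    unfolding eventually_at by auto
  obtain r where "r \<in> \<rat>" "t < r" "r < min (t + d) b"
    using Rats_dense_in_real[of t "min (t + d) b"] d(1) t by auto
  then show False using d(2)[of r] le[of r] t by (auto simp: dist_real_def)
qed

text \<open>Continuity in time makes each norm at s exceed the norm at t by at most 1 when s is near
  t; compactness then gives a uniform bound.\<close>

lemma in_L1_Linf_norm_bounds:
  fixes u :: "real \<Rightarrow> 'a::euclidean_space \<Rightarrow> real"
  assumes sol: "cauchy_solution J u\<^sub>0 u"
  shows "\<exists>S. \<forall>t\<in>{0..T}. real_of_ereal (Linf_norm (u t)) \<le> S"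
    and "\<exists>B. \<forall>t\<in>{0..T}. (\<integral>x. \<bar>u t x\<bar> \<partial>lebesgue) \<le> B"
proof -
  have L: "in_L1_Linf (u t)" if "0 \<le> t" for t using sol that by (simp add: cauchy_solution_def)
  have "\<forall>\<^sub>F s in at t within {0..}. real_of_ereal (Linf_norm (u s)) \<le> real_of_ereal (Linf_norm (u t)) + 1"
    if t: "0 \<le> t" for t
  proof -
    have "((\<lambda>s. Linf_norm (\<lambda>x. u s x - u t x)) \<longlongrightarrow> 0) (at t within {0..})"
      using sol t by (auto simp: cauchy_solution_def)
    then have "\<forall>\<^sub>F s in at t within {0..}. Linf_norm (\<lambda>x. u s x - u t x) < 1"
      by (rule order_tendstoD) simp
    moreover have "\<forall>\<^sub>F s in at t within {0..}. 0 \<le> s" by (auto simp: eventually_at_filter)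
    ultimately show ?thesis
    proof eventually_elim
      case (elim s)
      note lt = elim(1)
      have "AE x in lebesgue. ereal \<bar>u s x\<bar> \<le> ereal (real_of_ereal (Linf_norm (u t)) + 1)"
        using AE_le_Linf_norm[of "\<lambda>x. u s x - u t x"] in_L1_Linf_AE_bound[OF L[OF t]]
      proof eventually_elim
        case (elim x)
        have "ereal \<bar>u s x - u t x\<bar> < ereal 1" using le_less_trans[OF elim(1) lt] by (simp add: one_ereal_def)
        then show ?case using elim(2) by simp
      qed
      then have "Linf_norm (u s) \<le> ereal (real_of_ereal (Linf_norm (u t)) + 1)"
        unfolding Linf_norm_def using L[OF elim(2)] by (intro esssup_I) (auto simp: in_L1_Linf_def)
      then show ?case using Linf_norm_nonneg[of "u s"] by (cases "Linf_norm (u s)") auto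
    qed
  qed
  then show "\<exists>S. \<forall>t\<in>{0..T}. real_of_ereal (Linf_norm (u t)) \<le> S"
    by (rule locally_bounded_imp_bounded_Icc[where f="\<lambda>t. real_of_ereal (Linf_norm (u t))"])
  have "\<forall>\<^sub>F s in at t within {0..}. (\<integral>x. \<bar>u s x\<bar> \<partial>lebesgue) \<le> (\<integral>x. \<bar>u t x\<bar> \<partial>lebesgue) + 1"
    if t: "0 \<le> t" for t
  proof -
    have "((\<lambda>s. Lp_norm 1 (\<lambda>x. u s x - u t x)) \<longlongrightarrow> 0) (at t within {0..})"
      using sol t by (auto simp: cauchy_solution_def)
    then have "\<forall>\<^sub>F s in at t within {0..}. Lp_norm 1 (\<lambda>x. u s x - u t x) < 1"
      by (rule order_tendstoD) simp
    moreover have "\<forall>\<^sub>F s in at t within {0..}. 0 \<le> s" by (auto simp: eventually_at_filter)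
    ultimately show ?thesis
    proof eventually_elim
      case (elim s)
      note i = in_L1_Linf_imp_integrable[OF L[OF t]] in_L1_Linf_imp_integrable[OF L[OF elim(2)]]
      have "(\<integral>x. \<bar>u s x - u t x\<bar> \<partial>lebesgue) < 1"
        using elim(1) i by (simp add: Lp_norm_1 one_ereal_def)
      moreover have "(\<integral>x. \<bar>u s x\<bar> \<partial>lebesgue) \<le> (\<integral>x. \<bar>u t x\<bar> + \<bar>u s x - u t x\<bar> \<partial>lebesgue)"
        using i by (intro integral_mono) auto
      ultimately show ?case using i by simp
    qed
  qed
  then show "\<exists>B. \<forall>t\<in>{0..T}. (\<integral>x. \<bar>u t x\<bar> \<partial>lebesgue) \<le> B"
    by (rule locally_bounded_imp_bounded_Icc[where f="\<lambda>t. \<integral>x. \<bar>u t x\<bar> \<partial>lebesgue"])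
qed

text \<open>Norm bounds on \<open>u t\<close> hold off a null set that may vary with t. Setting u to
  0 on one null set, off which the equation and all bounds at rational times hold, gives a version
  that is continuous in time and locally bounded at every point.\<close>

lemma cauchy_solution_regular_version:
  fixes u :: "real \<Rightarrow> 'a::euclidean_space \<Rightarrow> real"
  assumes sol: "cauchy_solution J u\<^sub>0 u" and Jm[measurable]: "\<And>x. J x \<in> borel_measurable lebesgue"
  obtains v where "\<And>t. v t \<in> borel_measurable lebesgue" "\<And>x. continuous_on UNIV (\<lambda>t. v t x)"
    "\<And>t. 0 \<le> t \<Longrightarrow> AE x in lebesgue. v t x = u t x"
    "\<And>T. \<exists>S. \<forall>t\<in>{0..T}. \<forall>x. \<bar>v t x\<bar> \<le> S"
    "AE x in lebesgue. \<forall>t>0. ((\<lambda>s. v s x) has_real_derivative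
       (LINT y|lebesgue. J x y * (v t y - v t x))) (at t)"
proof -
  have L: "in_L1_Linf (u t)" if "0 \<le> t" for t using sol that by (simp add: cauchy_solution_def)
  define b where "b t = real_of_ereal (Linf_norm (u t))" for t
  \<comment> \<open>Rational times keep the number of exceptional sets countable. The last bound
    controls the distance to the initial value and gives continuity at time 0.\<close>
  define P where "P x \<longleftrightarrow> (\<forall>t>0. ((\<lambda>s. u s x) has_real_derivative
       (LINT y|lebesgue. J x y * (u t y - u t x))) (at t)) \<and>
     (\<forall>r\<in>\<rat> \<inter> {0..}. \<bar>u r x\<bar> \<le> b r \<and> ereal \<bar>u r x - u 0 x\<bar> \<le> Linf_norm (\<lambda>x. u r x - u 0 x))" for x
  have "AE x in lebesgue. \<forall>r\<in>\<rat> \<inter> {0..}. \<bar>u r x\<bar> \<le> b r \<and> ereal \<bar>u r x - u 0 x\<bar> \<le> Linf_norm (\<lambda>x. u r x - u 0 x)"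
    by (subst AE_ball_countable) (auto simp: countable_rat b_def intro: in_L1_Linf_AE_bound L AE_le_Linf_norm)
  moreover have "AE x in lebesgue. \<forall>t>0.
        ((\<lambda>s. u s x) has_real_derivative (LINT y|lebesgue. J x y * (u t y - u t x))) (at t)"
    using sol by (simp add: cauchy_solution_def)
  ultimately have "AE x in lebesgue. P x" unfolding P_def by eventually_elim blast
  then obtain N where PN: "{x \<in> space lebesgue. \<not> P x} \<subseteq> N" and "emeasure lebesgue N = 0" "N \<in> sets lebesgue"
    by (rule AE_E)
  then have N: "N \<in> null_sets lebesgue" by (intro null_setsI)
  have NP: "P x" if "x \<notin> N" for x using PN that by auto
  have AE_N: "AE x in lebesgue. x \<notin> N" using N by (rule AE_not_in)
  \<comment> \<open>Freezing the time at 0 for negative t makes every path continuous on the whole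
    line.\<close>
  define v where "v t x = (if x \<in> N then 0 else u (max 0 t) x)" for t x
  have vm: "v t \<in> borel_measurable lebesgue" for t
  proof -
    have [measurable]: "u (max 0 t) \<in> borel_measurable lebesgue" "N \<in> sets lebesgue"
      using L[of "max 0 t"] N by (auto simp: in_L1_Linf_def)
    show ?thesis unfolding v_def by measurable
  qed
  have vu: "AE x in lebesgue. v t x = u t x" if "0 \<le> t" for t
    using AE_N by eventually_elim (use that in \<open>simp add: v_def\<close>)
  have u_isCont: "isCont (\<lambda>t. u t x) t" if "x \<notin> N" "0 < t" for x t
    using NP[OF that(1)] that(2) DERIV_isCont unfolding P_def by blast
  have u_cont: "continuous_on {0..} (\<lambda>t. u t x)" if x: "x \<notin> N" for x
  proof -
    \<comment> \<open>The equation is posed for positive times only, so continuity at 0 has to come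
      from convergence in the essential supremum norm, tested at rational times.\<close>
    have "((\<lambda>t. u t x) \<longlongrightarrow> u 0 x) (at 0 within {0..})"
    proof (rule tendstoI)
      fix e :: real assume e: "0 < e"
      have "((\<lambda>s. Linf_norm (\<lambda>x. u s x - u 0 x)) \<longlongrightarrow> 0) (at 0 within {0..})"
        using sol by (auto simp: cauchy_solution_def)
      then have "\<forall>\<^sub>F s in at 0 within {0..}. Linf_norm (\<lambda>x. u s x - u 0 x) < ereal (e / 2)"
        by (rule order_tendstoD) (use e in simp)
      then obtain d where d: "d > 0" "\<And>s. 0 < s \<Longrightarrow> s < d \<Longrightarrow> Linf_norm (\<lambda>x. u s x - u 0 x) < ereal (e / 2)"
        unfolding eventually_at by (auto simp: dist_real_def)
      have "\<bar>u s x - u 0 x\<bar> \<le> e / 2" if s: "0 < s" "s < d" for s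
      proof (rule le_on_Rats_imp_le[OF _ _ s])
        show "continuous_on {0<..<d} (\<lambda>s. \<bar>u s x - u 0 x\<bar>)"
          by (intro continuous_intros continuous_at_imp_continuous_on) (auto intro: u_isCont[OF x])
        show "\<bar>u r x - u 0 x\<bar> \<le> e / 2" if r: "r \<in> \<rat>" "0 < r" "r < d" for r
        proof -
          have "ereal \<bar>u r x - u 0 x\<bar> \<le> Linf_norm (\<lambda>x. u r x - u 0 x)"
            using NP[OF x] r unfolding P_def by auto
          also have "\<dots> < ereal (e / 2)" using d(2) r by blast
          finally show ?thesis by simp
        qed
      qed
      note bd = this
      have "dist (u s x) (u 0 x) < e" if "0 < s" "s < d" for s
        using bd[OF that] e unfolding dist_real_def by linarith
      then show "\<forall>\<^sub>F s in at 0 within {0..}. dist (u s x) (u 0 x) < e"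
        unfolding eventually_at using d(1) by (intro exI[of _ d]) (simp add: dist_real_def)
    qed
    note at_0 = this
    have "continuous (at t within {0..}) (\<lambda>t. u t x)" if "t \<in> {0..}" for t
    proof (cases "t = 0")
      case True
      then show ?thesis using at_0 unfolding continuous_within by simp
    next
      case False
      then show ?thesis using that by (simp add: u_isCont[OF x] continuous_at_imp_continuous_at_within)
    qed
    then show ?thesis unfolding continuous_on_eq_continuous_within by blast
  qed
  have v_cont: "continuous_on UNIV (\<lambda>t. v t x)" for x
  proof (cases "x \<in> N")
    case False
    have "continuous_on UNIV (\<lambda>t. u (max 0 t) x)"
      by (rule continuous_on_compose2[OF u_cont[OF False] continuous_on_max[OF continuous_on_const continuous_on_id]]) auto
    then show ?thesis by (simp add: v_def False)
  qed (simp add: v_def)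
  have v_bd: "\<exists>S. \<forall>t\<in>{0..T}. \<forall>x. \<bar>v t x\<bar> \<le> S" for T
  proof -
    obtain S where S: "\<And>t. t \<in> {0..\<bar>T\<bar> + 1} \<Longrightarrow> b t \<le> S"
      using in_L1_Linf_norm_bounds(1)[OF sol, of "\<bar>T\<bar> + 1"] unfolding b_def by blast
    have S0: "0 \<le> S" using S[of 0] real_of_ereal_pos[OF Linf_norm_nonneg[of "u 0"]] unfolding b_def by force
    have "\<bar>v t x\<bar> \<le> S" if t: "t \<in> {0..T}" for t x
    proof (cases "x \<in> N")
      case False
      show ?thesis
      \<comment> \<open>The open interval is chosen so that 0 and T are interior points; negative
        rational times are reduced to 0 by \<open>max 0 r\<close>.\<close>
      proof (rule le_on_Rats_imp_le[where g="\<lambda>t. \<bar>v t x\<bar>" and a="-1" and b="\<bar>T\<bar> + 1"])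
        show "continuous_on {-1<..<\<bar>T\<bar> + 1} (\<lambda>t. \<bar>v t x\<bar>)"
          by (intro continuous_intros continuous_on_subset[OF v_cont]) auto
        show "\<bar>v r x\<bar> \<le> S" if r: "r \<in> \<rat>" "-1 < r" "r < \<bar>T\<bar> + 1" for r
        proof -
          have "max 0 r \<in> \<rat> \<inter> {0..}" using r by (auto simp: max_def)
          then have "\<bar>u (max 0 r) x\<bar> \<le> b (max 0 r)" using NP[OF False] unfolding P_def by blast
          also have "\<dots> \<le> S" using r by (intro S) auto
          finally show ?thesis using False by (simp add: v_def)
        qed
      qed (use t in auto)
    qed (simp add: v_def S0)
    then show ?thesis by blast
  qed
  have v_deriv: "((\<lambda>s. v s x) has_real_derivative (LINT y|lebesgue. J x y * (v t y - v t x))) (at t)"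
    if x: "x \<notin> N" and t: "0 < t" for x t
  proof -
    \<comment> \<open>Passing to the version changes the integrand only on a null set of y, since x
      itself is outside N.\<close>
    have "(LINT y|lebesgue. J x y * (v t y - v t x)) = (LINT y|lebesgue. J x y * (u t y - u t x))"
    proof (rule integral_cong_AE)
      have [measurable]: "u t \<in> borel_measurable lebesgue" "v t \<in> borel_measurable lebesgue"
        using L[of t] t vm by (auto simp: in_L1_Linf_def)
      show "(\<lambda>y. J x y * (v t y - v t x)) \<in> borel_measurable lebesgue"
        "(\<lambda>y. J x y * (u t y - u t x)) \<in> borel_measurable lebesgue" by measurable
      show "AE y in lebesgue. J x y * (v t y - v t x) = J x y * (u t y - u t x)"
        using vu[of t] t by (auto elim!: eventually_mono simp: v_def x max_def)
    qed
    moreover have "((\<lambda>s. u s x) has_real_derivative (LINT y|lebesgue. J x y * (u t y - u t x))) (at t)"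
      using NP[OF x] t unfolding P_def by blast
    ultimately have "((\<lambda>s. u s x) has_real_derivative (LINT y|lebesgue. J x y * (v t y - v t x))) (at t)"
      by simp
    then show ?thesis
      by (rule has_field_derivative_transform_within_open[where S="{0<..}"]) (use t x in \<open>auto simp: v_def\<close>)
  qed
  have "AE x in lebesgue. \<forall>t>0. ((\<lambda>s. v s x) has_real_derivative
       (LINT y|lebesgue. J x y * (v t y - v t x))) (at t)"
    using AE_N by eventually_elim (use v_deriv in blast)
  with vm v_cont vu v_bd show ?thesis by (rule that)
qed

section \<open>Nonlocal evolutions\<close>

text \<open>Rounding the time variable down to a grid leaves countably many time slices.\<close>
lemma borel_measurable_Caratheodory:
  fixes v :: "real \<Rightarrow> 'a \<Rightarrow> real"
  assumes meas: "\<And>t. v t \<in> borel_measurable M"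
    and cont: "\<And>x. x \<in> space M \<Longrightarrow> continuous_on UNIV (\<lambda>t. v t x)"
  shows "(\<lambda>(t, x). v t x) \<in> borel_measurable (borel \<Otimes>\<^sub>M M)"
proof -
  define g where "g n z = v (of_int \<lfloor>fst z * of_nat (Suc n)\<rfloor> / of_nat (Suc n)) (snd z)" for n :: nat and z :: "real \<times> 'a"
  have "g n \<in> borel_measurable (borel \<Otimes>\<^sub>M M)" for n
    unfolding g_def
    by (rule measurable_compose_countable[where g="\<lambda>z. \<lfloor>fst z * of_nat (Suc n)\<rfloor>" and
          f="\<lambda>i z. v (of_int i / of_nat (Suc n)) (snd z)"])
       (use meas in measurable)
  moreover have "(\<lambda>n. g n z) \<longlonglongrightarrow> (\<lambda>(t, x). v t x) z" if "z \<in> space (borel \<Otimes>\<^sub>M M)" for z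
  proof -
    obtain t x where z: "z = (t, x)" "x \<in> space M" using \<open>z \<in> _\<close> by (auto simp: space_pair_measure)
    have "(\<lambda>n. of_int \<lfloor>t * of_nat (Suc n)\<rfloor> / of_nat (Suc n)) \<longlonglongrightarrow> t"
    proof (rule real_tendsto_sandwich)
      show "\<forall>\<^sub>F n in sequentially. t - 1 / real (Suc n) \<le> of_int \<lfloor>t * of_nat (Suc n)\<rfloor> / of_nat (Suc n)"
      proof (intro always_eventually allI)
        fix n
        have "(t * real (Suc n) - 1) / real (Suc n) \<le> of_int \<lfloor>t * of_nat (Suc n)\<rfloor> / of_nat (Suc n)"
          by (intro divide_right_mono) linarith+
        then show "t - 1 / real (Suc n) \<le> of_int \<lfloor>t * of_nat (Suc n)\<rfloor> / of_nat (Suc n)"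
          by (simp add: diff_divide_distrib del: of_nat_Suc)
      qed
      show "\<forall>\<^sub>F n in sequentially. of_int \<lfloor>t * of_nat (Suc n)\<rfloor> / of_nat (Suc n) \<le> t"
        by (intro always_eventually allI) (simp add: divide_le_eq del: of_nat_Suc)
      have "(\<lambda>n. t - 1 / real (Suc n)) \<longlonglongrightarrow> t - 0"
        by (intro tendsto_intros LIMSEQ_Suc lim_1_over_n)
      then show "(\<lambda>n. t - 1 / real (Suc n)) \<longlonglongrightarrow> t" by simp
    qed simp
    then show ?thesis
      using continuous_on_tendsto_compose[OF cont[OF z(2)]] by (simp add: g_def z)
  qed
  ultimately show ?thesis by (rule borel_measurable_LIMSEQ_real[rotated])
qed

text \<open>The abstract setting of the estimates, with bounds and continuity in time at every
  point, as a regular version provides. The geometry of the space enters through the comparison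
  kernel \<open>j\<close> given to the individual lemmas.\<close>

locale nonlocal_evolution = sigma_finite_measure M for M :: "'a measure" +
  fixes J :: "'a \<Rightarrow> 'a \<Rightarrow> real" and K :: real and v :: "real \<Rightarrow> 'a \<Rightarrow> real"
  assumes J_measurable: "(\<lambda>(x, y). J x y) \<in> borel_measurable (M \<Otimes>\<^sub>M M)"
    and J_nonneg: "\<And>x y. 0 \<le> J x y" and J_le: "\<And>x y. J x y \<le> K" and J_sym: "\<And>x y. J x y = J y x"
    and J_integrable: "\<And>x. x \<in> space M \<Longrightarrow> integrable M (J x)"
    and v_measurable: "\<And>t. v t \<in> borel_measurable M"
    and v_continuous: "\<And>x. x \<in> space M \<Longrightarrow> continuous_on UNIV (\<lambda>t. v t x)"
    and v_bounded: "\<And>T. \<exists>S. \<forall>t\<in>{0..T}. \<forall>x. \<bar>v t x\<bar> \<le> S"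
    and v_integrable: "\<And>t. 0 \<le> t \<Longrightarrow> integrable M (v t)"
    and v_L1_bounded: "\<And>T. \<exists>B. \<forall>t\<in>{0..T}. (\<integral>x. \<bar>v t x\<bar> \<partial>M) \<le> B"
    and v_equation: "AE x in M. \<forall>t>0. ((\<lambda>s. v s x) has_real_derivative
       (\<integral>y. J x y * (v t y - v t x) \<partial>M)) (at t)"
begin

text \<open>The equation is autonomous, so a time shift by s reduces the claim to an estimate
  starting at time 0.\<close>

lemma tpow_decay:
  assumes p: "1 < p" and m: "0 < m" and s: "0 \<le> s" "s \<le> t"
    and jm: "(\<lambda>(x, y). j x y) \<in> borel_measurable (M \<Otimes>\<^sub>M M)"
    and j: "\<And>x y. 0 \<le> j x y" "\<And>x y. j x y \<le> J x y" "\<And>x y. j x y = j y x" "\<And>x y. j x y \<le> \<beta>"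
      "\<And>x. x \<in> space M \<Longrightarrow> (\<integral>y. j x y \<partial>M) = \<alpha>"
    and B: "\<And>r. r \<in> {s..t} \<Longrightarrow> (\<integral>x. \<bar>v r x\<bar> \<partial>M) \<le> B" "\<beta> * B \<le> \<alpha> * m"
  shows "(\<integral>x. tpow m p (v t x) \<partial>M) \<le> exp (- (\<alpha> * p) * (t - s)) * (\<integral>x. tpow m p (v s x) \<partial>M)"
proof -
  obtain S where S: "\<forall>r\<in>{0..t}. \<forall>x. \<bar>v r x\<bar> \<le> S" using v_bounded by blast
  have cont: "continuous_on A (\<lambda>r. v (s + r) x)" if "x \<in> space M" for x A
    by (rule continuous_on_compose2[OF v_continuous[OF that]]) (auto intro!: continuous_intros)
  have "(\<integral>x. tpow m p (v (s + (t - s)) x) \<partial>M)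
      \<le> exp (- (\<alpha> * p) * (t - s)) * (\<integral>x. tpow m p (v (s + 0) x) \<partial>M)"
  proof (rule integral_tpow_decay[OF p m _ J_measurable jm J_le J_sym J_integrable j, where v="\<lambda>r. v (s + r)" and S=S and B=B])
    show "(\<lambda>(r, x). v (s + r) x) \<in> borel_measurable (borel \<Otimes>\<^sub>M M)"
      by (rule borel_measurable_Caratheodory[OF v_measurable cont])
    show "AE x in M. \<forall>r\<in>{0<..<t - s}. ((\<lambda>r. v (s + r) x) has_real_derivative
       (\<integral>y. J x y * (v (s + r) y - v (s + r) x) \<partial>M)) (at r)"
      using v_equation
    proof eventually_elim
      case (elim x)
      show ?case
      proof
        fix r assume "r \<in> {0<..<t - s}"
        then have "0 < r + s" using s by simp
        then have "((\<lambda>r. v r x) has_real_derivative (\<integral>y. J x y * (v (r + s) y - v (r + s) x) \<partial>M)) (at (r + s))"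
          using elim by blast
        then show "((\<lambda>r. v (s + r) x) has_real_derivative
            (\<integral>y. J x y * (v (s + r) y - v (s + r) x) \<partial>M)) (at r)"
          unfolding DERIV_shift by (simp add: add.commute)
      qed
    qed
  qed (use s S B in \<open>auto intro: v_integrable cont\<close>)
  then show ?thesis by simp
qed

text \<open>On a bounded time interval |v| is at most some S, so |v|^p is dominated by S^(p - 1)
  |v|.\<close>

lemma powr_integrable:
  assumes p: "1 \<le> p" and t: "0 \<le> t"
  shows "integrable M (\<lambda>x. \<bar>v t x\<bar> powr p)"
proof -
  obtain S where S: "\<forall>r\<in>{0..t}. \<forall>x. \<bar>v r x\<bar> \<le> S" using v_bounded by blast
  note [measurable] = v_measurable
  show ?thesis
  proof (rule Bochner_Integration.integrable_bound)
    show "integrable M (\<lambda>x. S powr (p - 1) * \<bar>v t x\<bar>)" using v_integrable[OF t] by auto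
    have "\<bar>v t x\<bar> powr p \<le> S powr (p - 1) * \<bar>v t x\<bar>" for x
    proof (cases "v t x = 0")
      case False
      then have "\<bar>v t x\<bar> powr p = \<bar>v t x\<bar> powr (p - 1) * \<bar>v t x\<bar>" by (simp add: powr_diff)
      also have "\<dots> \<le> S powr (p - 1) * \<bar>v t x\<bar>"
        using S t p by (intro mult_right_mono powr_mono2) auto
      finally show ?thesis .
    qed simp
    then show "AE x in M. norm (\<bar>v t x\<bar> powr p) \<le> norm (S powr (p - 1) * \<bar>v t x\<bar>)"
      by (intro AE_I2) (simp add: abs_mult)
  qed measurable
qed

lemma tpow_integrable:
  assumes "0 < m" "1 \<le> p" "0 \<le> t"
  shows "integrable M (\<lambda>x. tpow m p (v t x))"
proof (rule Bochner_Integration.integrable_bound[OF powr_integrable[OF assms(2,3)]])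
  note [measurable] = v_measurable
  show "(\<lambda>x. tpow m p (v t x)) \<in> borel_measurable M" by measurable
  show "AE x in M. norm (tpow m p (v t x)) \<le> norm (\<bar>v t x\<bar> powr p)"
    using assms by (intro AE_I2) (simp add: tpow_nonneg tpow_le_powr)
qed

text \<open>The case \<open>j = 0\<close> of the decay estimate, in the limit where both the truncation level and \<open>p - 1\<close> vanish.\<close>
lemma L1_contraction:
  assumes t: "0 \<le> t"
  shows "(\<integral>x. \<bar>v t x\<bar> \<partial>M) \<le> (\<integral>x. \<bar>v 0 x\<bar> \<partial>M)"
proof -
  define e where "e k = 1 / real (Suc k)" for k
  have e: "0 < e k" "e k \<le> 1" for k by (auto simp: e_def)
  have e_lim: "e \<longlonglongrightarrow> 0" unfolding e_def by (intro LIMSEQ_Suc lim_1_over_n)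
  obtain S where S: "\<forall>r\<in>{0..t}. \<forall>x. \<bar>v r x\<bar> \<le> S" using v_bounded by blast
  have lim: "(\<lambda>k. \<integral>x. tpow (e k) (1 + e k) (v r x) \<partial>M) \<longlonglongrightarrow> (\<integral>x. \<bar>v r x\<bar> \<partial>M)" if r: "r \<in> {0..t}" for r
  proof (rule integral_dominated_convergence)
    note [measurable] = v_measurable
    show "(\<lambda>x. \<bar>v r x\<bar>) \<in> borel_measurable M" "\<And>k. (\<lambda>x. tpow (e k) (1 + e k) (v r x)) \<in> borel_measurable M"
      by measurable
    \<comment> \<open>The excess exponent \<open>e k\<close> is at most 1, so |v|^(e k) is bounded
      by 1 + S; adding 1 makes the base at least 1 and the bound uniform in k.\<close>
    show "integrable M (\<lambda>x. (1 + S) * \<bar>v r x\<bar>)" using v_integrable[of r] r by auto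
    have "(\<lambda>k. tpow (e k) (1 + e k) a) \<longlonglongrightarrow> \<bar>a\<bar>" for a :: real
    proof (cases "a = 0")
      case True
      then show ?thesis using e by (simp add: tpow_eq)
    next
      case False
      have "(\<lambda>k. max 0 (\<bar>a\<bar> - e k) powr (1 + e k)) \<longlonglongrightarrow> max 0 (\<bar>a\<bar> - 0) powr (1 + 0)"
        using False by (intro tendsto_intros e_lim) auto
      then show ?thesis using e by (simp add: tpow_eq)
    qed
    then show "AE x in M. (\<lambda>k. tpow (e k) (1 + e k) (v r x)) \<longlonglongrightarrow> \<bar>v r x\<bar>" by simp
    show "AE x in M. norm (tpow (e k) (1 + e k) (v r x)) \<le> (1 + S) * \<bar>v r x\<bar>" for k
    proof (rule AE_I2)
      fix x
      have S0: "\<bar>v r x\<bar> \<le> S" using S r by blast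
      have "norm (tpow (e k) (1 + e k) (v r x)) \<le> \<bar>v r x\<bar> powr (1 + e k)"
        using tpow_le_powr[OF e(1), of "1 + e k" k "v r x"] e(1)[of k] by (simp add: tpow_nonneg)
      also have "\<dots> \<le> \<bar>v r x\<bar> * (1 + S) powr 1"
      proof (cases "v r x = 0")
        case False
        have "\<bar>v r x\<bar> powr (1 + e k) = \<bar>v r x\<bar> * \<bar>v r x\<bar> powr e k" using False by (simp add: powr_add)
        also have "\<bar>v r x\<bar> powr e k \<le> (1 + S) powr e k"
          using S0 e[of k] by (intro powr_mono2) auto
        also have "(1 + S) powr e k \<le> (1 + S) powr 1"
          using S0 e[of k] by (intro powr_mono) auto
        finally show ?thesis by (simp add: mult_left_mono)
      qed simp
      finally show "norm (tpow (e k) (1 + e k) (v r x)) \<le> (1 + S) * \<bar>v r x\<bar>"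
        using S0 by (simp add: mult.commute)
    qed
  qed
  obtain B where B: "\<And>r. r \<in> {0..t} \<Longrightarrow> (\<integral>x. \<bar>v r x\<bar> \<partial>M) \<le> B" using v_L1_bounded by blast
  have "(\<integral>x. tpow (e k) (1 + e k) (v t x) \<partial>M) \<le> (\<integral>x. tpow (e k) (1 + e k) (v 0 x) \<partial>M)" for k
    using tpow_decay[of "1 + e k" "e k" 0 t "\<lambda>_ _. 0" 0 0 B] e[of k] t B J_nonneg by simp
  then show ?thesis
    using t by (intro LIMSEQ_le[OF lim lim]) auto
qed

text \<open>With B the initial mass, the level m = B / V is the smallest that satisfies the mass
  condition for a kernel of height \<beta> and total mass \<beta> V. Values above 2 m are controlled
  by the decaying truncated power, values below by m^(p - 1) |v|, whose integral is bounded through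
  the contraction of mass.\<close>

lemma powr_integral_decay:
  assumes p: "1 < p" and s: "0 \<le> s" "s \<le> t" and V: "0 < V" and \<beta>: "0 \<le> \<beta>"
    and jm: "(\<lambda>(x, y). j x y) \<in> borel_measurable (M \<Otimes>\<^sub>M M)"
    and j: "\<And>x y. 0 \<le> j x y" "\<And>x y. j x y \<le> J x y" "\<And>x y. j x y = j y x" "\<And>x y. j x y \<le> \<beta>"
      "\<And>x. x \<in> space M \<Longrightarrow> (\<integral>y. j x y \<partial>M) = \<beta> * V"
  shows "(\<integral>x. \<bar>v t x\<bar> powr p \<partial>M) \<le> 2 powr p * (exp (- (\<beta> * V * p) * (t - s)) * (\<integral>x. \<bar>v s x\<bar> powr p \<partial>M)
      + V powr - (p - 1) * (\<integral>x. \<bar>v 0 x\<bar> \<partial>M) powr p)"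
proof -
  define B where "B = (\<integral>x. \<bar>v 0 x\<bar> \<partial>M)"
  have B0: "0 \<le> B" by (simp add: B_def)
  \<comment> \<open>For zero mass any positive level will do, and 1 is taken because the truncation
    needs m > 0.\<close>
  define m where "m = (if B = 0 then 1 else B / V)"
  have m: "0 < m" using B0 V by (auto simp: m_def)
  have Bm: "B \<le> V * m" using V by (simp add: m_def)
  have mB: "m powr (p - 1) * B = V powr - (p - 1) * B powr p"
  proof (cases "B = 0")
    case False
    then show ?thesis using B0 V
      by (simp add: m_def powr_divide powr_diff powr_minus field_simps)
  qed simp
  have t: "0 \<le> t" using s by simp
  \<comment> \<open>Beyond 2 m one has |a| \<le> 2 (|a| - m); up to 2 m the power p - 1 of |a| is
    bounded by that of 2 m.\<close>
  have pw: "\<bar>a\<bar> powr p \<le> 2 powr p * (tpow m p a + m powr (p - 1) * \<bar>a\<bar>)" for a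
  proof (cases "\<bar>a\<bar> \<le> 2 * m")
    case True
    have "\<bar>a\<bar> powr p \<le> \<bar>a\<bar> * (2 * m) powr (p - 1)"
    proof (cases "a = 0")
      case False
      then have "\<bar>a\<bar> powr p = \<bar>a\<bar> * \<bar>a\<bar> powr (p - 1)" by (simp add: powr_diff)
      also have "\<dots> \<le> \<bar>a\<bar> * (2 * m) powr (p - 1)"
        using True p by (intro mult_left_mono powr_mono2) auto
      finally show ?thesis .
    qed simp
    also have "\<dots> = 2 powr (p - 1) * (m powr (p - 1) * \<bar>a\<bar>)"
      using m by (simp add: powr_mult)
    also have "\<dots> \<le> 2 powr p * (m powr (p - 1) * \<bar>a\<bar>)"
      by (intro mult_right_mono powr_mono) auto
    also have "\<dots> \<le> 2 powr p * (tpow m p a + m powr (p - 1) * \<bar>a\<bar>)"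
      using tpow_nonneg by (intro mult_left_mono) auto
    finally show ?thesis .
  next
    case False
    have "\<bar>a\<bar> powr p \<le> (2 * max 0 (\<bar>a\<bar> - m)) powr p"
      using False p m by (intro powr_mono2) auto
    also have "\<dots> = 2 powr p * tpow m p a" using m by (simp add: powr_mult tpow_eq)
    also have "\<dots> \<le> 2 powr p * (tpow m p a + m powr (p - 1) * \<bar>a\<bar>)"
      by (intro mult_left_mono) auto
    finally show ?thesis .
  qed
  have "(\<integral>x. \<bar>v t x\<bar> powr p \<partial>M) \<le> (\<integral>x. 2 powr p * (tpow m p (v t x) + m powr (p - 1) * \<bar>v t x\<bar>) \<partial>M)"
    using powr_integrable[of p t] tpow_integrable[OF m, of p t] v_integrable[OF t] p t pw
    by (intro integral_mono) auto
  also have "\<dots> = 2 powr p * ((\<integral>x. tpow m p (v t x) \<partial>M) + m powr (p - 1) * (\<integral>x. \<bar>v t x\<bar> \<partial>M))"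
    using tpow_integrable[OF m, of p t] v_integrable[OF t] p t by simp
  also have "(\<integral>x. tpow m p (v t x) \<partial>M) \<le> exp (- (\<beta> * V * p) * (t - s)) * (\<integral>x. tpow m p (v s x) \<partial>M)"
  proof (rule tpow_decay[OF p m s jm j])
    show "(\<integral>x. \<bar>v r x\<bar> \<partial>M) \<le> B" if "r \<in> {s..t}" for r
      using L1_contraction[of r] that s by (simp add: B_def)
    show "\<beta> * B \<le> \<beta> * V * m" using mult_left_mono[OF Bm \<beta>] by (simp add: mult.assoc)
  qed
  also have "(\<integral>x. tpow m p (v s x) \<partial>M) \<le> (\<integral>x. \<bar>v s x\<bar> powr p \<partial>M)"
    using powr_integrable[of p s] tpow_integrable[OF m, of p s] p s m
    by (intro integral_mono tpow_le_powr) auto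
  also have "m powr (p - 1) * (\<integral>x. \<bar>v t x\<bar> \<partial>M) \<le> m powr (p - 1) * B"
    using L1_contraction[OF t] by (intro mult_left_mono) (auto simp: B_def)
  finally show ?thesis by (simp add: mB B_def[symmetric] mult_left_mono)
qed

end

section \<open>Iteration in time\<close>

text \<open>Choosing \<open>\<rho>\<close> proportional to \<open>t\<close> and \<open>s = t / 2\<close> gives \<open>G t \<le> G (t / 2) / 2 + const \<cdot> N\<close>
  for \<open>G t = t\<^sup>\<theta> Y t\<close>, which is then iterated.\<close>
lemma polynomial_decay_of_two_time_bounds:
  fixes a b \<theta> \<rho>\<^sub>0 D :: real
  assumes pos: "0 < a" "0 < b" "0 \<le> \<theta>" "0 < \<rho>\<^sub>0" "0 < D"
  obtains C where "0 < C"
    "\<And>(Y :: real \<Rightarrow> real) N. \<lbrakk>\<And>t. 0 \<le> Y t; 0 \<le> N;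
        \<And>s t \<rho>. 0 \<le> s \<Longrightarrow> s \<le> t \<Longrightarrow> \<rho>\<^sub>0 \<le> \<rho> \<Longrightarrow>
          Y t \<le> D * (exp (- a * (t - s) / \<rho>) * Y s + b * \<rho> powr - \<theta> * N)\<rbrakk> \<Longrightarrow>
      (\<forall>t>0. t powr \<theta> * Y t \<le> C * max (Y 0) N) \<and>
      (\<forall>\<epsilon>>0. \<forall>\<^sub>F t in at_top. t powr \<theta> * Y t \<le> C * N + \<epsilon>)"
proof -
  \<comment> \<open>The exponent is large enough to absorb both D and the factor 2^\<theta> that
    arises when t^\<theta> is rewritten in terms of (t / 2)^\<theta>.\<close>
  define k where "k = max 1 (ln (2 * D * 2 powr \<theta>))"
  have k: "0 < k" and "D * 2 powr \<theta> * exp (- k) \<le> 1 / 2"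
  proof -
    have "2 * D * 2 powr \<theta> = exp (ln (2 * D * 2 powr \<theta>))" using pos by simp
    also have "\<dots> \<le> exp k" by (simp add: k_def)
    finally show "D * 2 powr \<theta> * exp (- k) \<le> 1 / 2" by (simp add: exp_minus field_simps)
  qed (simp add: k_def)
  note half = this(2)
  \<comment> \<open>With \<rho> = \<delta> t and s = t / 2 the exponential becomes exp (-k). From
    the time \<open>t\<^sub>0\<close> on, this \<rho> is admissible.\<close>
  define \<delta> where "\<delta> = a / (2 * k)"
  have \<delta>: "0 < \<delta>" using pos k by (simp add: \<delta>_def)
  define t\<^sub>0 where "t\<^sub>0 = \<rho>\<^sub>0 / \<delta>"
  have t\<^sub>0: "0 < t\<^sub>0" using pos \<delta> by (simp add: t\<^sub>0_def)
  define B where "B = D * b * \<delta> powr - \<theta>"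
  \<comment> \<open>Controls t^\<theta> Y t up to time \<open>t\<^sub>0\<close>, by comparison with
    time 0 at the smallest admissible \<rho>.\<close>
  define Z where "Z = t\<^sub>0 powr \<theta> * D * (1 + b * \<rho>\<^sub>0 powr - \<theta>)"
  have B: "0 < B" and Z: "0 < Z" using pos \<delta> t\<^sub>0 by (auto simp: B_def Z_def intro!: mult_pos_pos add_pos_pos)
  show ?thesis
  proof (rule that[of "Z + 2 * B"])
    show "0 < Z + 2 * B" using B Z by simp
    fix Y :: "real \<Rightarrow> real" and N :: real
    assume Y: "\<And>t. 0 \<le> Y t" and N: "0 \<le> N"
      and YY: "\<And>s t \<rho>. 0 \<le> s \<Longrightarrow> s \<le> t \<Longrightarrow> \<rho>\<^sub>0 \<le> \<rho> \<Longrightarrow>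
          Y t \<le> D * (exp (- a * (t - s) / \<rho>) * Y s + b * \<rho> powr - \<theta> * N)"
    define G where "G t = t powr \<theta> * Y t" for t
    define W where "W = Z * max (Y 0) N"
    have W: "0 \<le> W" using Z Y[of 0] by (simp add: W_def)
    have BN: "0 \<le> B * N" using B N by simp
    have step: "G t \<le> G (t / 2) / 2 + B * N" if t: "t\<^sub>0 \<le> t" for t
    proof -
      have t': "0 < t" using t t\<^sub>0 by simp
      have "\<rho>\<^sub>0 \<le> \<delta> * t" using t \<delta> by (simp add: t\<^sub>0_def field_simps)
      then have "Y t \<le> D * (exp (- a * (t - t / 2) / (\<delta> * t)) * Y (t / 2) + b * (\<delta> * t) powr - \<theta> * N)"
        using t' by (intro YY) auto
      also have "- a * (t - t / 2) / (\<delta> * t) = - k"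
        using t' k pos by (simp add: \<delta>_def field_simps)
      finally have "G t \<le> t powr \<theta> * (D * (exp (- k) * Y (t / 2) + b * (\<delta> * t) powr - \<theta> * N))"
        unfolding G_def by (intro mult_left_mono) auto
      also have "\<dots> = (D * 2 powr \<theta> * exp (- k)) * ((t / 2) powr \<theta> * Y (t / 2)) + B * N"
        using t' \<delta> by (simp add: B_def powr_mult powr_divide powr_minus field_simps)
      also have "\<dots> \<le> 1 / 2 * ((t / 2) powr \<theta> * Y (t / 2)) + B * N"
        using Y by (intro add_right_mono mult_right_mono half) auto
      finally show ?thesis by (simp add: G_def)
    qed
    have small: "G t \<le> W" if t: "0 < t" "t \<le> t\<^sub>0" for t
    proof -
      have "Y t \<le> D * (exp (- a * (t - 0) / \<rho>\<^sub>0) * Y 0 + b * \<rho>\<^sub>0 powr - \<theta> * N)"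
        using t by (intro YY) auto
      also have "\<dots> \<le> D * (1 * max (Y 0) N + b * \<rho>\<^sub>0 powr - \<theta> * max (Y 0) N)"
        using pos t Y by (intro mult_left_mono add_mono mult_mono) auto
      finally have Yt: "Y t \<le> D * (1 + b * \<rho>\<^sub>0 powr - \<theta>) * max (Y 0) N" by (simp add: algebra_simps)
      have "G t \<le> t\<^sub>0 powr \<theta> * (D * (1 + b * \<rho>\<^sub>0 powr - \<theta>) * max (Y 0) N)"
        unfolding G_def using t pos Y by (intro mult_mono Yt powr_mono2) auto
      then show ?thesis by (simp add: W_def Z_def mult.assoc)
    qed
    \<comment> \<open>The map g to g / 2 + B N has the fixed point 2 B N and halves the excess over
      it, so the bound survives every doubling of time.\<close>
    have bound: "G t \<le> W + 2 * (B * N)" if "0 < t" "t \<le> 2 ^ i * t\<^sub>0" for i t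
      using that
    proof (induction i arbitrary: t)
      case 0
      then show ?case using small[of t] BN by simp
    next
      case (Suc i)
      show ?case
      proof (cases "t \<le> t\<^sub>0")
        case True
        then show ?thesis using small[of t] Suc.prems BN by simp
      next
        case False
        have "G (t / 2) \<le> W + 2 * (B * N)" using Suc.prems by (intro Suc.IH) auto
        then show ?thesis using step[of t] False W by simp
      qed
    qed
    have bound': "G t \<le> W + 2 * (B * N)" if t: "0 < t" for t
    proof -
      obtain i where "t / t\<^sub>0 < 2 ^ i" using real_arch_pow[of 2 "t / t\<^sub>0"] by auto
      then show ?thesis using t t\<^sub>0 by (intro bound[of _ i]) (auto simp: field_simps)
    qed
    \<comment> \<open>Each doubling of time halves the contribution W of the initial value, so that
      asymptotically only N remains.\<close>
    have late: "G t \<le> W / 2 ^ i + 2 * (B * N)" if "2 ^ i * t\<^sub>0 \<le> t" for i t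
      using that
    proof (induction i arbitrary: t)
      case 0
      then show ?case using bound'[of t] t\<^sub>0 by simp
    next
      case (Suc i)
      have "G (t / 2) \<le> W / 2 ^ i + 2 * (B * N)" using Suc.prems by (intro Suc.IH) auto
      moreover have "t\<^sub>0 \<le> t"
      proof -
        have "1 * t\<^sub>0 \<le> 2 ^ Suc i * t\<^sub>0" using t\<^sub>0 by (intro mult_right_mono one_le_power) auto
        then show ?thesis using Suc.prems by simp
      qed
      ultimately show ?case using step[of t] by simp
    qed
    show "(\<forall>t>0. t powr \<theta> * Y t \<le> (Z + 2 * B) * max (Y 0) N) \<and>
      (\<forall>\<epsilon>>0. \<forall>\<^sub>F t in at_top. t powr \<theta> * Y t \<le> (Z + 2 * B) * N + \<epsilon>)"
    proof (intro conjI allI impI)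
      fix t :: real assume "0 < t"
      then have "G t \<le> Z * max (Y 0) N + 2 * (B * N)" using bound' by (simp add: W_def)
      also have "\<dots> \<le> (Z + 2 * B) * max (Y 0) N" using B by (simp add: distrib_right mult.assoc)
      finally show "t powr \<theta> * Y t \<le> (Z + 2 * B) * max (Y 0) N" by (simp add: G_def)
    next
      fix \<epsilon> :: real assume \<epsilon>: "0 < \<epsilon>"
      obtain i where "W / \<epsilon> < 2 ^ i" using real_arch_pow[of 2 "W / \<epsilon>"] by auto
      then have i: "W / 2 ^ i \<le> \<epsilon>" using \<epsilon> by (simp add: field_simps)
      show "\<forall>\<^sub>F t in at_top. t powr \<theta> * Y t \<le> (Z + 2 * B) * N + \<epsilon>"
        using eventually_ge_at_top[of "2 ^ i * t\<^sub>0"]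
      proof eventually_elim
        case (elim t)
        have "0 \<le> Z * N" using Z N by simp
        then show ?case using late[OF elim] i by (simp add: G_def algebra_simps)
      qed
    qed
  qed
qed

section \<open>Comparison with a constant kernel on an annulus\<close>

lemma sigma_finite_lebesgue: "sigma_finite_measure (lebesgue :: 'a::euclidean_space measure)"
proof
  obtain A :: "'a set set" where "countable A" "A \<subseteq> sets lborel" "\<Union>A = space lborel" "\<forall>a\<in>A. emeasure lborel a \<noteq> \<infinity>"
    using lborel.sigma_finite_countable by blast
  then show "\<exists>A :: 'a set set. countable A \<and> A \<subseteq> sets lebesgue \<and> \<Union>A = space lebesgue \<and> (\<forall>a\<in>A. emeasure lebesgue a \<noteq> \<infinity>)"
    by (intro exI[of _ A]) (auto simp: subset_iff)
qed

text \<open>Completion only adds measurable sets, so the identity is measurable from the product of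
  the completed spaces into the Borel product.\<close>

lemma borel_measurable_pair_lebesgue:
  fixes f :: "'a::euclidean_space \<times> 'b::euclidean_space \<Rightarrow> real"
  assumes "f \<in> borel_measurable borel"
  shows "f \<in> borel_measurable (lebesgue \<Otimes>\<^sub>M lebesgue)"
proof -
  have "(\<lambda>z. (fst z, snd z)) \<in> lebesgue \<Otimes>\<^sub>M lebesgue \<rightarrow>\<^sub>M (borel :: 'a measure) \<Otimes>\<^sub>M (borel :: 'b measure)"
    by (intro measurable_Pair measurable_compose[OF measurable_fst] measurable_compose[OF measurable_snd])
       (auto intro: measurable_completion)
  then show ?thesis
    using measurable_compose[of "\<lambda>z. z" "lebesgue \<Otimes>\<^sub>M lebesgue" borel f borel] assms by (simp add: borel_prod)
qed

lemma measure_annulus: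
  fixes x :: "'a::euclidean_space"
  assumes "0 < c" "c \<le> R"
  defines "A \<equiv> {y. c < norm (x - y) \<and> norm (x - y) < R}"
  shows "A \<in> sets lebesgue" and "emeasure lebesgue A < \<infinity>"
    and "measure lebesgue A = (R ^ DIM('a) - c ^ DIM('a)) * measure lborel (ball (0::'a) 1)"
proof -
  have A: "A = ball x R - cball x c" by (auto simp: A_def dist_norm)
  show "A \<in> sets lebesgue" unfolding A by auto
  have "emeasure lebesgue A \<le> emeasure lebesgue (ball x R)" unfolding A by (intro emeasure_mono) auto
  also have "\<dots> < \<infinity>" using emeasure_lborel_ball_finite[of x R] by simp
  finally show "emeasure lebesgue A < \<infinity>" .
  have "measure lebesgue A = measure lborel (ball x R) - measure lborel (cball x c)"
  \<comment> \<open>If the radii agree, the closed ball is not contained in the open one, and the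
    formula for the measure of a difference does not apply.\<close>
  proof (cases "c = R")
    case True
    then have "A = {}" by (auto simp: A_def)
    then have "measure lebesgue A = 0" by simp
    then show ?thesis using True by (simp add: content_cball_conv_ball)
  next
    case False
    have "measure lebesgue A = measure lborel (ball x R - cball x c)" unfolding A by (simp add: measure_completion)
    also have "\<dots> = measure lborel (ball x R) - measure lborel (cball x c)"
      using assms(1,2) False emeasure_lborel_ball_finite[of x R] by (intro measure_Diff) auto
    finally show ?thesis .
  qed
  then show "measure lebesgue A = (R ^ DIM('a) - c ^ DIM('a)) * measure lborel (ball (0::'a) 1)"
    using assms(1,2) content_ball_conv_unit_ball[of R x] content_ball_conv_unit_ball[of c x]
    by (simp add: content_cball_conv_ball left_diff_distrib)
qed

lemma cauchy_solution_imp_nonlocal_evolution: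
  fixes J :: "real ^ 'n \<Rightarrow> real ^ 'n \<Rightarrow> real"
  assumes adm: "admissible_kernel \<sigma> c\<^sub>1 c\<^sub>2 J" and sol: "cauchy_solution J u\<^sub>0 u"
  obtains v K where "nonlocal_evolution lebesgue J K v" "\<And>t. 0 \<le> t \<Longrightarrow> AE x in lebesgue. v t x = u t x"
proof -
  \<comment> \<open>Integrability is given in the first argument of the kernel; symmetry transfers
    it to the second.\<close>
  have J_int: "integrable lebesgue (J x)" for x
  proof -
    have "J x = (\<lambda>y. J y x)" using adm by (auto simp: admissible_kernel_def)
    then show ?thesis using adm by (simp add: admissible_kernel_def)
  qed
  then have Jm: "J x \<in> borel_measurable lebesgue" for x by auto
  show ?thesis
  proof (rule cauchy_solution_regular_version[OF sol Jm])
    fix v assume v: "\<And>t. v t \<in> borel_measurable lebesgue" "\<And>x. continuous_on UNIV (\<lambda>t. v t x)"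
      "\<And>t. 0 \<le> t \<Longrightarrow> AE x in lebesgue. v t x = u t x"
      "\<And>T. \<exists>S. \<forall>t\<in>{0..T}. \<forall>x. \<bar>v t x\<bar> \<le> S"
      "AE x in lebesgue. \<forall>t>0. ((\<lambda>s. v s x) has_real_derivative
         (LINT y|lebesgue. J x y * (v t y - v t x))) (at t)"
    have u_int: "integrable lebesgue (u t)" if "0 \<le> t" for t
      using sol that by (auto simp: cauchy_solution_def intro: in_L1_Linf_imp_integrable)
    have "bounded (range (\<lambda>(x, y). J x y))" using adm by (simp add: admissible_kernel_def)
    then obtain K where "\<forall>z\<in>range (\<lambda>(x, y). J x y). norm z \<le> K" unfolding bounded_iff by blast
    then have K: "norm (J x y) \<le> K" for x y
      using rangeI[of "\<lambda>(x, y). J x y" "(x, y)"] by simp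
    have "nonlocal_evolution lebesgue J K v"
    proof (intro nonlocal_evolution.intro sigma_finite_lebesgue nonlocal_evolution_axioms.intro)
      have "(\<lambda>(x, y). J x y) \<in> borel_measurable borel"
        using adm by (intro borel_measurable_continuous_onI) (auto simp: admissible_kernel_def)
      then show "(\<lambda>(x, y). J x y) \<in> borel_measurable (lebesgue \<Otimes>\<^sub>M lebesgue)"
        by (rule borel_measurable_pair_lebesgue)
      show v_int: "integrable lebesgue (v t)" if "0 \<le> t" for t
        using integrable_cong_AE_imp[OF u_int[OF that] v(1)] v(3)[OF that] by (auto simp: eq_commute)
      show "\<exists>B. \<forall>t\<in>{0..T}. (LINT x|lebesgue. \<bar>v t x\<bar>) \<le> B" for T
      proof -
        have "(LINT x|lebesgue. \<bar>v t x\<bar>) = (LINT x|lebesgue. \<bar>u t x\<bar>)" if "0 \<le> t" for t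
          using v(3)[OF that] v_int[OF that] u_int[OF that] by (intro integral_cong_AE) auto
        then show ?thesis using in_L1_Linf_norm_bounds(2)[OF sol, of T] by auto
      qed
      show "J x y \<le> K" for x y using K[of x y] by simp
    qed (use v adm J_int in \<open>auto simp: admissible_kernel_def\<close>)
    then show ?thesis using v(3) by (rule that)
  qed
qed

text \<open>The inner radius is at most R / 2, so the inner ball takes up at most the fraction
  2^(-n), hence at most half, of the outer one.\<close>

lemma annulus_lower_bounds:
  fixes R c :: real
  assumes c: "0 < c" and R: "2 * c \<le> R" and n: "0 < n"
  shows "R ^ n / 2 \<le> R ^ n - c ^ n"
proof -
  have "c ^ n \<le> (R / 2) ^ n" using c R by (intro power_mono) auto
  also have "\<dots> = R ^ n / 2 ^ n" by (simp add: power_divide)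
  also have "\<dots> \<le> R ^ n / 2 ^ 1" using n c R by (intro divide_left_mono power_increasing) auto
  finally show ?thesis by simp
qed

text \<open>The parameter \<rho> is R^(2 \<sigma>) for the outer radius R of the annulus. The volume
  V is at least half that of the ball of radius R, so \<beta> V is at least \<open>c\<^sub>1\<close>
  \<omega> / (2 \<rho>), and V^(-(q - 1)) is controlled by the power -n (q - 1) / (2 \<sigma>) of
  \<rho>.\<close>

lemma cauchy_solution_two_time_bound:
  fixes J :: "real ^ 'n \<Rightarrow> real ^ 'n \<Rightarrow> real"
  defines "\<omega> \<equiv> measure lborel (ball (0::real^'n) 1)" and "n \<equiv> real CARD('n)"
  assumes adm: "admissible_kernel \<sigma> c\<^sub>1 c\<^sub>2 J" and sol: "cauchy_solution J u\<^sub>0 u"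
    and pos: "0 < \<sigma>" "0 < c\<^sub>1" "0 < c\<^sub>2" and q: "1 < q"
    and st: "0 \<le> s" "s \<le> t" and \<rho>: "(2 * c\<^sub>2) powr (2 * \<sigma>) \<le> \<rho>"
  shows "(LINT x|lebesgue. \<bar>u t x\<bar> powr q) \<le> 2 powr q * (exp (- (q * c\<^sub>1 * \<omega> / 2) * (t - s) / \<rho>) * (LINT x|lebesgue. \<bar>u s x\<bar> powr q)
     + (\<omega> / 2) powr - (q - 1) * \<rho> powr - (n / (2 * \<sigma>) * (q - 1)) * (LINT x|lebesgue. \<bar>u 0 x\<bar>) powr q)"
proof -
  obtain v K where "nonlocal_evolution lebesgue J K v"
    and vu: "\<And>t. 0 \<le> t \<Longrightarrow> AE x in lebesgue. v t x = u t x"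
    using cauchy_solution_imp_nonlocal_evolution[OF adm sol] by blast
  interpret nonlocal_evolution lebesgue J K v by fact
  have u_meas: "u r \<in> borel_measurable lebesgue" if "0 \<le> r" for r
    using sol that by (simp add: cauchy_solution_def in_L1_Linf_def)
  have eq: "(LINT x|lebesgue. \<bar>v r x\<bar> powr q) = (LINT x|lebesgue. \<bar>u r x\<bar> powr q)"
    and eq1: "(LINT x|lebesgue. \<bar>v r x\<bar>) = (LINT x|lebesgue. \<bar>u r x\<bar>)" if "0 \<le> r" for r
    using vu[OF that] u_meas[OF that] v_measurable[of r] by (auto intro!: integral_cong_AE)
  define R where "R = \<rho> powr (1 / (2 * \<sigma>))"
  have "0 < (2 * c\<^sub>2) powr (2 * \<sigma>)" using pos by simp
  then have \<rho>0: "0 < \<rho>" using \<rho> by linarith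
  have R: "2 * c\<^sub>2 \<le> R"
  proof -
    have "((2 * c\<^sub>2) powr (2 * \<sigma>)) powr (1 / (2 * \<sigma>)) \<le> R"
      unfolding R_def using \<rho> pos by (intro powr_mono2) auto
    then show ?thesis using pos by (simp add: powr_powr)
  qed
  have R0: "0 < R" using R pos by simp
  have "R ^ CARD('n) = R powr n" using R0 by (simp add: n_def powr_realpow)
  then have Rn: "R ^ CARD('n) = \<rho> powr (n / (2 * \<sigma>))" by (simp add: R_def powr_powr)
  have R\<sigma>: "R powr - (2 * \<sigma>) = 1 / \<rho>"
    using \<rho>0 pos by (simp add: R_def powr_powr powr_minus_divide)
  have \<omega>: "0 < \<omega>" unfolding \<omega>_def by (simp add: content_ball_pos)
  define V where "V = (R ^ CARD('n) - c\<^sub>2 ^ CARD('n)) * \<omega>"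
  have V_ge: "\<omega> / 2 * R ^ CARD('n) \<le> V"
    using annulus_lower_bounds[OF pos(3) R, of "CARD('n)"] \<omega>
    by (simp add: V_def mult.commute mult_left_mono)
  have "0 < \<omega> / 2 * R ^ CARD('n)" using \<omega> R0 by simp
  then have V: "0 < V" using V_ge by linarith
  \<comment> \<open>The lower bound for J decreases with distance, so its value at the outer radius
    lies below J throughout the annulus.\<close>
  define \<beta> where "\<beta> = c\<^sub>1 * R powr - (n + 2 * \<sigma>)"
  have \<beta>: "0 \<le> \<beta>" using pos by (simp add: \<beta>_def)
  define D where "D = {z :: real ^ 'n. c\<^sub>2 < norm z \<and> norm z < R}"
  define j where "j x y = \<beta> * indicator D (x - y)" for x y :: "real ^ 'n"
  have decay: "(LINT x|lebesgue. \<bar>v t x\<bar> powr q) \<le> 2 powr q * (exp (- (\<beta> * V * q) * (t - s)) * (LINT x|lebesgue. \<bar>v s x\<bar> powr q)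
      + V powr - (q - 1) * (LINT x|lebesgue. \<bar>v 0 x\<bar>) powr q)"
  proof (rule powr_integral_decay[OF q st V \<beta>])
    have [measurable]: "D \<in> sets borel" unfolding D_def by measurable
    have "(\<lambda>(x, y). j x y) \<in> borel_measurable borel"
      unfolding j_def borel_prod[symmetric] by measurable
    then show "(\<lambda>(x, y). j x y) \<in> borel_measurable (lebesgue \<Otimes>\<^sub>M lebesgue)"
      by (rule borel_measurable_pair_lebesgue)
    show "0 \<le> j x y" "j x y \<le> \<beta>" for x y using \<beta> by (auto simp: j_def indicator_def)
    show "j x y = j y x" for x y
      by (simp add: j_def D_def indicator_def norm_minus_commute)
    show "j x y \<le> J x y" for x y
    proof (cases "x - y \<in> D")
      case True
      then have "\<beta> \<le> c\<^sub>1 * norm (x - y) powr - (n + 2 * \<sigma>)"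
        unfolding \<beta>_def using pos by (intro mult_left_mono powr_mono2') (auto simp: D_def n_def)
      also have "\<dots> \<le> J x y" using adm True by (auto simp: admissible_kernel_def D_def n_def)
      finally show ?thesis using True by (simp add: j_def)
    qed (simp add: j_def J_nonneg)
    show "(LINT y|lebesgue. j x y) = \<beta> * V" for x
    proof -
      have "(\<lambda>y. j x y) = (\<lambda>y. \<beta> * indicator {y. c\<^sub>2 < norm (x - y) \<and> norm (x - y) < R} y)"
        by (auto simp: j_def D_def indicator_def)
      then show ?thesis
        using measure_annulus[of c\<^sub>2 R x] pos R by (simp add: V_def \<omega>_def)
    qed
  qed
  have "q * c\<^sub>1 * \<omega> / 2 / \<rho> \<le> \<beta> * V * q"
  proof -
    have "R powr - (n + 2 * \<sigma>) * R ^ CARD('n) = R powr - (2 * \<sigma>)"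
      using \<open>R ^ CARD('n) = R powr n\<close> by (simp flip: powr_add)
    then have "R powr - (n + 2 * \<sigma>) * R ^ CARD('n) = 1 / \<rho>" by (simp only: R\<sigma>)
    then have "c\<^sub>1 * (R powr - (n + 2 * \<sigma>) * R ^ CARD('n)) * (\<omega> / 2) * q = c\<^sub>1 * (1 / \<rho>) * (\<omega> / 2) * q"
      by simp
    then have "q * c\<^sub>1 * \<omega> / 2 / \<rho> = c\<^sub>1 * R powr - (n + 2 * \<sigma>) * (\<omega> / 2 * R ^ CARD('n)) * q"
      by (simp add: mult_ac)
    also have "\<dots> \<le> \<beta> * V * q"
      unfolding \<beta>_def using pos q V_ge by (intro mult_right_mono mult_left_mono) auto
    finally show ?thesis .
  qed
  then have "q * c\<^sub>1 * \<omega> / 2 / \<rho> * (t - s) \<le> \<beta> * V * q * (t - s)"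
    using st by (intro mult_right_mono) auto
  then have E: "exp (- (\<beta> * V * q) * (t - s)) \<le> exp (- (q * c\<^sub>1 * \<omega> / 2) * (t - s) / \<rho>)" by simp
  have "V powr - (q - 1) \<le> (\<omega> / 2 * R ^ CARD('n)) powr - (q - 1)"
    using V_ge \<omega> R0 q by (intro powr_mono2') auto
  also have "\<dots> = (\<omega> / 2) powr - (q - 1) * \<rho> powr - (n / (2 * \<sigma>) * (q - 1))"
    unfolding Rn using \<omega> \<rho>0 by (subst powr_mult) (simp_all only: powr_powr mult_minus_right powr_ge_zero)
  finally have "V powr - (q - 1) \<le> (\<omega> / 2) powr - (q - 1) * \<rho> powr - (n / (2 * \<sigma>) * (q - 1))" .
  with E have "2 powr q * (exp (- (\<beta> * V * q) * (t - s)) * (LINT x|lebesgue. \<bar>v s x\<bar> powr q)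
      + V powr - (q - 1) * (LINT x|lebesgue. \<bar>v 0 x\<bar>) powr q)
    \<le> 2 powr q * (exp (- (q * c\<^sub>1 * \<omega> / 2) * (t - s) / \<rho>) * (LINT x|lebesgue. \<bar>v s x\<bar> powr q)
     + (\<omega> / 2) powr - (q - 1) * \<rho> powr - (n / (2 * \<sigma>) * (q - 1)) * (LINT x|lebesgue. \<bar>v 0 x\<bar>) powr q)"
    by (intro mult_left_mono add_mono mult_right_mono) auto
  from order_trans[OF decay this] show ?thesis
    unfolding eq[OF order_trans[OF st]] eq[OF st(1)] eq1[OF order_refl] .
qed

lemma cauchy_solution_integral_properties:
  fixes J :: "real ^ 'n \<Rightarrow> real ^ 'n \<Rightarrow> real"
  assumes adm: "admissible_kernel \<sigma> c\<^sub>1 c\<^sub>2 J" and sol: "cauchy_solution J u\<^sub>0 u" and t: "0 \<le> t"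
  shows "(LINT x|lebesgue. \<bar>u t x\<bar>) \<le> (LINT x|lebesgue. \<bar>u 0 x\<bar>)"
    and "1 \<le> q \<Longrightarrow> integrable lebesgue (\<lambda>x. \<bar>u t x\<bar> powr q)"
proof -
  obtain v K where "nonlocal_evolution lebesgue J K v"
    and vu: "\<And>t. 0 \<le> t \<Longrightarrow> AE x in lebesgue. v t x = u t x"
    using cauchy_solution_imp_nonlocal_evolution[OF adm sol] by blast
  interpret nonlocal_evolution lebesgue J K v by fact
  have u_meas[measurable]: "u r \<in> borel_measurable lebesgue" if "0 \<le> r" for r
    using sol that by (simp add: cauchy_solution_def in_L1_Linf_def)
  have "(LINT x|lebesgue. \<bar>v r x\<bar>) = (LINT x|lebesgue. \<bar>u r x\<bar>)" if "0 \<le> r" for r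
    using vu[OF that] u_meas[OF that] v_measurable[of r] by (auto intro!: integral_cong_AE)
  then show "(LINT x|lebesgue. \<bar>u t x\<bar>) \<le> (LINT x|lebesgue. \<bar>u 0 x\<bar>)"
    using L1_contraction[OF t] t by simp
  show "integrable lebesgue (\<lambda>x. \<bar>u t x\<bar> powr q)" if "1 \<le> q"
    using powr_integrable[OF that t]
  proof (rule integrable_cong_AE_imp)
    show "(\<lambda>x. \<bar>u t x\<bar> powr q) \<in> borel_measurable lebesgue" using u_meas[OF t] by measurable
    show "AE x in lebesgue. \<bar>v t x\<bar> powr q = \<bar>u t x\<bar> powr q" using vu[OF t] by eventually_elim simp
  qed
qed

section \<open>The decay estimates\<close>

theorem theorem1p1:
  fixes \<sigma> q c\<^sub>1 c\<^sub>2 :: real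
  assumes "CARD('n::finite) \<ge> 2"
    and "0 < \<sigma>" and "\<sigma> < 1"
    and "2 * \<sigma> < q" and "1 \<le> q"
    and "0 < c\<^sub>1" and "0 < c\<^sub>2"
  shows "\<exists>C::real. C > 0 \<and>
    (\<forall>(J :: real ^ 'n \<Rightarrow> real ^ 'n \<Rightarrow> real) u\<^sub>0 u.
       admissible_kernel \<sigma> c\<^sub>1 c\<^sub>2 J \<and> in_L1_Linf u\<^sub>0 \<and> cauchy_solution J u\<^sub>0 u \<longrightarrow>
         (1 < q \<longrightarrow> ((\<lambda>t. Lp_norm q (u t)) \<longlongrightarrow> 0) at_top) \<and>
         Limsup at_top
           (\<lambda>t. ereal (t powr (real CARD('n) / (2 * \<sigma>) * (1 - 1 / q))) * Lp_norm q (u t))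
           \<le> ereal C * Lp_norm 1 u\<^sub>0 \<and>
         (\<forall>t>0. Lp_norm q (u t) \<le>
           ereal C * max (Lp_norm 1 u\<^sub>0) (Lp_norm q u\<^sub>0)
             * ereal (t powr - (real CARD('n) / (2 * \<sigma>) * (1 - 1 / q)))))"
proof -
  \<comment> \<open>The initial value is attained only almost everywhere, so its norms are
    transferred to \<open>u 0\<close>.\<close>
  have norm_0: "Lp_norm p u\<^sub>0 = Lp_norm p (u 0)"
    if "cauchy_solution J u\<^sub>0 u" "in_L1_Linf u\<^sub>0" for p J u\<^sub>0 and u :: "real \<Rightarrow> real ^ 'n \<Rightarrow> real"
  proof -
    have [measurable]: "u\<^sub>0 \<in> borel_measurable lebesgue" "u 0 \<in> borel_measurable lebesgue"
      and "AE x in lebesgue. u 0 x = u\<^sub>0 x"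
      using that by (auto simp: cauchy_solution_def in_L1_Linf_def)
    from this(3) have ae: "AE x in lebesgue. \<bar>u\<^sub>0 x\<bar> powr p = \<bar>u 0 x\<bar> powr p" by eventually_elim simp
    have "integrable lebesgue (\<lambda>x. \<bar>u\<^sub>0 x\<bar> powr p) \<longleftrightarrow> integrable lebesgue (\<lambda>x. \<bar>u 0 x\<bar> powr p)"
      by (rule integrable_cong_AE[OF _ _ ae]) measurable
    moreover have "(LINT x|lebesgue. \<bar>u\<^sub>0 x\<bar> powr p) = (LINT x|lebesgue. \<bar>u 0 x\<bar> powr p)"
      by (rule integral_cong_AE[OF _ _ ae]) measurable
    ultimately show ?thesis by (simp only: Lp_norm_def)
  qed
  show ?thesis
  proof (cases "q = 1")
    \<comment> \<open>The time exponent is 0 here, and contraction of mass gives both bounds with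
      constant 1.\<close>
    case True
    have L1: "Lp_norm 1 (u t) \<le> Lp_norm 1 u\<^sub>0"
      if adm: "admissible_kernel \<sigma> c\<^sub>1 c\<^sub>2 J" and "in_L1_Linf u\<^sub>0" and sol: "cauchy_solution J u\<^sub>0 u" and t: "0 \<le> t"
      for J :: "real ^ 'n \<Rightarrow> real ^ 'n \<Rightarrow> real" and u\<^sub>0 u t
    proof -
      have "integrable lebesgue (u r)" if "0 \<le> r" for r
        using sol that by (auto simp: cauchy_solution_def intro: in_L1_Linf_imp_integrable)
      then show ?thesis
        using cauchy_solution_integral_properties(1)[OF adm sol t] t
        by (simp add: norm_0[OF sol \<open>in_L1_Linf u\<^sub>0\<close>] Lp_norm_1)
    qed
    show ?thesis
    proof (intro exI[of _ 1] conjI allI impI; (elim conjE)?)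
      fix J :: "real ^ 'n \<Rightarrow> real ^ 'n \<Rightarrow> real" and u\<^sub>0 u
      assume "admissible_kernel \<sigma> c\<^sub>1 c\<^sub>2 J" "in_L1_Linf u\<^sub>0" "cauchy_solution J u\<^sub>0 u"
      note L1 = L1[OF this]
      \<comment> \<open>The convention \<open>0 powr 0 = 0\<close> restricts this to positive times,
        which suffices for the limit superior.\<close>
      have eq: "ereal (t powr (real CARD('n) / (2 * \<sigma>) * (1 - 1 / q))) = 1"
        "ereal (t powr - (real CARD('n) / (2 * \<sigma>) * (1 - 1 / q))) = 1" if "0 < t" for t
        using that by (simp_all add: True one_ereal_def)
      show "Limsup at_top
           (\<lambda>t. ereal (t powr (real CARD('n) / (2 * \<sigma>) * (1 - 1 / q))) * Lp_norm q (u t))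
           \<le> ereal 1 * Lp_norm 1 u\<^sub>0"
        by (intro Limsup_bounded eventually_mono[OF eventually_gt_at_top[of 0]])
           (simp only: eq, use L1 in \<open>simp add: True flip: one_ereal_def\<close>)
      show "Lp_norm q (u t) \<le> ereal 1 * max (Lp_norm 1 u\<^sub>0) (Lp_norm q u\<^sub>0)
             * ereal (t powr - (real CARD('n) / (2 * \<sigma>) * (1 - 1 / q)))" if "0 < t" for t
        using L1[of t] that by (simp only: eq) (simp add: True flip: one_ereal_def)
    qed (simp_all add: True)
  next
    case False
    with assms have q: "1 < q" by simp
    define n where "n = real CARD('n)"
    define \<omega> where "\<omega> = measure lborel (ball (0::real^'n) 1)"
    have \<omega>: "0 < \<omega>" by (simp add: \<omega>_def content_ball_pos)
    \<comment> \<open>\<theta> is the rate for the integral of |u|^q; taking the q-th root turns it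
      into the rate e of the norm.\<close>
    define \<theta> where "\<theta> = n / (2 * \<sigma>) * (q - 1)"
    define e where "e = n / (2 * \<sigma>) * (1 - 1 / q)"
    have e: "e = \<theta> / q" and e0: "0 < e"
      using q assms by (auto simp: e_def \<theta>_def n_def field_simps)
    have \<theta>: "0 \<le> \<theta>" using q assms by (simp add: \<theta>_def n_def)
    \<comment> \<open>The constant is fixed before the kernel and the solution; the parameters
      supplied depend only on n, \<sigma>, q, \<open>c\<^sub>1\<close> and
      \<open>c\<^sub>2\<close>.\<close>
    obtain C where C: "0 < C"
      and decay: "\<And>(Y :: real \<Rightarrow> real) N. \<lbrakk>\<And>t. 0 \<le> Y t; 0 \<le> N;
        \<And>s t \<rho>. 0 \<le> s \<Longrightarrow> s \<le> t \<Longrightarrow> (2 * c\<^sub>2) powr (2 * \<sigma>) \<le> \<rho> \<Longrightarrow>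
          Y t \<le> 2 powr q * (exp (- (q * c\<^sub>1 * \<omega> / 2) * (t - s) / \<rho>) * Y s + (\<omega> / 2) powr - (q - 1) * \<rho> powr - \<theta> * N)\<rbrakk> \<Longrightarrow>
      (\<forall>t>0. t powr \<theta> * Y t \<le> C * max (Y 0) N) \<and>
      (\<forall>\<epsilon>>0. \<forall>\<^sub>F t in at_top. t powr \<theta> * Y t \<le> C * N + \<epsilon>)"
      by (rule polynomial_decay_of_two_time_bounds[of "q * c\<^sub>1 * \<omega> / 2" "(\<omega> / 2) powr - (q - 1)" \<theta>
            "(2 * c\<^sub>2) powr (2 * \<sigma>)" "2 powr q"])
         (use q \<omega> \<theta> assms in auto)
    define C' where "C' = C powr (1 / q)"
    have C': "0 < C'" using C by (simp add: C'_def)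
    show ?thesis
    proof (intro exI[of _ C'] conjI allI impI C'; (elim conjE)?)
      fix J :: "real ^ 'n \<Rightarrow> real ^ 'n \<Rightarrow> real" and u\<^sub>0 u
      assume adm: "admissible_kernel \<sigma> c\<^sub>1 c\<^sub>2 J" and u0: "in_L1_Linf u\<^sub>0" and sol: "cauchy_solution J u\<^sub>0 u"
      define Y where "Y t = (LINT x|lebesgue. \<bar>u t x\<bar> powr q)" for t
      define B where "B = (LINT x|lebesgue. \<bar>u 0 x\<bar>)"
      have Y: "0 \<le> Y t" for t by (simp add: Y_def)
      have B: "0 \<le> B" by (simp add: B_def)
      \<comment> \<open>Integrability of the q-th power puts the norm on its finite branch.\<close>
      have norm_q: "Lp_norm q (u t) = ereal (Y t powr (1 / q))" if "0 \<le> t" for t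
        using cauchy_solution_integral_properties(2)[OF adm sol that assms(5)] by (simp add: Lp_norm_def Y_def)
      have norm_1: "Lp_norm 1 u\<^sub>0 = ereal B"
        using sol by (simp add: norm_0[OF sol u0] B_def Lp_norm_1 cauchy_solution_def in_L1_Linf_imp_integrable)
      \<comment> \<open>The iteration is applied with N equal to the q-th power of the initial mass,
        as suggested by the homogeneity of the two-time bound.\<close>
      have all: "\<forall>t>0. t powr \<theta> * Y t \<le> C * max (Y 0) (B powr q)"
        and ev: "\<forall>\<epsilon>>0. \<forall>\<^sub>F t in at_top. t powr \<theta> * Y t \<le> C * B powr q + \<epsilon>"
        using decay[of Y "B powr q"] Y
          cauchy_solution_two_time_bound[OF adm sol assms(2,6,7) q]
        unfolding Y_def B_def \<omega>_def \<theta>_def n_def by auto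
      have bound: "Y t powr (1 / q) \<le> C' * max B (Y 0 powr (1 / q)) * t powr - e" if t: "0 < t" for t
      proof -
        have "max (Y 0) (B powr q) powr (1 / q) \<le> max B (Y 0 powr (1 / q))"
          using q B by (cases "Y 0 \<le> B powr q") (auto simp: powr_powr max_def)
        have "Y t \<le> C * max (Y 0) (B powr q) * t powr - \<theta>"
          using all t by (simp add: powr_minus field_simps)
        then have "Y t powr (1 / q) \<le> (C * max (Y 0) (B powr q) * t powr - \<theta>) powr (1 / q)"
          using Y q by (intro powr_mono2) auto
        also have "\<dots> = C' * max (Y 0) (B powr q) powr (1 / q) * t powr - e"
          using C Y[of 0] by (simp add: C'_def powr_mult powr_powr e)
        also have "\<dots> \<le> C' * max B (Y 0 powr (1 / q)) * t powr - e"
          using C' \<open>max (Y 0) (B powr q) powr (1 / q) \<le> _\<close> by (intro mult_right_mono mult_left_mono) auto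
        finally show ?thesis .
      qed
      show "Lp_norm q (u t) \<le> ereal C' * max (Lp_norm 1 u\<^sub>0) (Lp_norm q u\<^sub>0)
             * ereal (t powr - (real CARD('n) / (2 * \<sigma>) * (1 - 1 / q)))" if "0 < t" for t
        using bound[OF that] that
        by (simp add: norm_q norm_1 norm_0[OF sol u0, of q] e_def n_def max_def split: if_splits)
      show "((\<lambda>t. Lp_norm q (u t)) \<longlongrightarrow> 0) at_top"
      proof -
        have "((\<lambda>t. C' * max B (Y 0 powr (1 / q)) * t powr - e) \<longlongrightarrow> C' * max B (Y 0 powr (1 / q)) * 0) at_top"
          using e0 by (intro tendsto_mult_left tendsto_neg_powr[OF _ filterlim_ident]) simp
        then have lim: "((\<lambda>t. C' * max B (Y 0 powr (1 / q)) * t powr - e) \<longlongrightarrow> 0) at_top" by simp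
        have "((\<lambda>t. Y t powr (1 / q)) \<longlongrightarrow> 0) at_top"
        proof (rule tendsto_sandwich[OF _ _ tendsto_const lim])
          show "\<forall>\<^sub>F t in at_top. Y t powr (1 / q) \<le> C' * max B (Y 0 powr (1 / q)) * t powr - e"
            using eventually_gt_at_top[of 0] by eventually_elim (rule bound)
        qed simp
        then have "((\<lambda>t. ereal (Y t powr (1 / q))) \<longlongrightarrow> ereal 0) at_top" by (rule tendsto_ereal)
        moreover have "\<forall>\<^sub>F t in at_top. ereal (Y t powr (1 / q)) = Lp_norm q (u t)"
          using eventually_ge_at_top[of 0] by eventually_elim (simp add: norm_q)
        ultimately show ?thesis unfolding zero_ereal_def by (rule Lim_transform_eventually)
      qed
      show "Limsup at_top
           (\<lambda>t. ereal (t powr (real CARD('n) / (2 * \<sigma>) * (1 - 1 / q))) * Lp_norm q (u t))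
           \<le> ereal C' * Lp_norm 1 u\<^sub>0"
      proof (rule ereal_le_epsilon2, rule Limsup_bounded)
        fix d :: real assume d: "0 < d"
        have CB: "(C' * B) powr q = C * B powr q" using C B q by (simp add: C'_def powr_mult powr_powr)
        \<comment> \<open>Chosen so that the additive error \<epsilon> for the q-th powers becomes
          exactly d after the q-th root.\<close>
        define \<epsilon> where "\<epsilon> = (C' * B + d) powr q - C * B powr q"
        have "(C' * B) powr q < (C' * B + d) powr q"
          using d C' B q by (intro powr_less_mono2) auto
        then have "0 < \<epsilon>" by (simp add: \<epsilon>_def CB)
        then have "\<forall>\<^sub>F t in at_top. t powr \<theta> * Y t \<le> C * B powr q + \<epsilon>" using ev by blast
        then have "\<forall>\<^sub>F t in at_top. t powr \<theta> * Y t \<le> (C' * B + d) powr q" by (simp add: \<epsilon>_def)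
        then show "\<forall>\<^sub>F t in at_top. ereal (t powr (real CARD('n) / (2 * \<sigma>) * (1 - 1 / q))) * Lp_norm q (u t)
            \<le> ereal C' * Lp_norm 1 u\<^sub>0 + ereal d"
          using eventually_gt_at_top[of 0]
        proof eventually_elim
          case (elim t)
          have "t powr e * Y t powr (1 / q) = (t powr \<theta> * Y t) powr (1 / q)"
            using Y by (simp add: powr_mult powr_powr e)
          also have "\<dots> \<le> ((C' * B + d) powr q) powr (1 / q)"
            using elim Y q by (intro powr_mono2) auto
          also have "\<dots> = C' * B + d" using q C' B d by (simp add: powr_powr)
          finally show ?case using elim by (simp add: norm_q norm_1 e_def n_def)
        qed
      qed
    qed
  qed
qed

end
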